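(* Let $n,p\in\mathbb{N}$, $\mu\in\mathbb{C}$, $\alpha\ge 0$, $\beta\in\mathbb{R}$, $\alpha+i\beta\neq 0$, $-1\le B\le 1$, $A\in\mathbb{R}$, and $A\neq B$. If $f\in N_{p,\mu}^{n}(\alpha,\beta,A,B)$, then for every $z\in\mathbb{U}$ $$\inf_{\zeta\in\mathbb{U}}\operatorname{Re}\left\{\frac{p(\alpha+i\beta)}{\mu n}\int_{0}^{1}\frac{1+A\zeta u}{1+B\zeta u}\,u^{\frac{p(\alpha+i\beta)}{\mu n}-1}du\right\}<\operatorname{Re}\left(\frac{z^{p}}{f(z)}\right)^{\alpha+i\beta}<\sup_{\zeta\in\mathbb{U}}\operatorname{Re}\left\{\frac{p(\alpha+i\beta)}{\mu n}\int_{0}^{1}\frac{1+A\zeta u}{1+B\zeta u}\,u^{\frac{p(\alpha+i\beta)}{\mu n}-1}du\right\}.$$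
   Context: $\mathbb{U}=\{z\in\mathbb{C}:|z|<1\}$ and $\mathbb{N}=\{1,2,3,\dots\}$. Infima and suprema are taken in the extended reals. For $p,n\in\mathbb{N}$, $\mathcal{A}_p$ is the class of functions $f(z)=z^{p}+\sum_{k=n}^{\infty}a_{k+p}z^{k+p}$ that are analytic and $p$-valent in $\mathbb{U}$ ($p$-valent: no value is taken more than $p$ times, counted with multiplicity, and some value is taken exactly $p$ times). The function $z^p/f(z)$ is extended by the value $1$ at $z=0$. For $F,G$ analytic in $\mathbb{U}$, $F\prec G$ ($F$ is subordinate to $G$) means there is an analytic $w:\mathbb{U}\to\mathbb{C}$ with $w(0)=0$, $|w(z)|<1$ on $\mathbb{U}$, and $F(z)=G(w(z))$ for all $z\in\mathbb{U}$. $N_{p,\mu}^{n}(\alpha,\beta,A,B)$ is the class of $f\in\mathcal{A}_p$ such that $$(1+\mu)\left(\frac{z^{p}}{f(z)}\right)^{\alpha+i\beta}-\mu\left(\frac{zf'(z)}{pf(z)}\right)\left(\frac{z^{p}}{f(z)}\right)^{\alpha+i\beta}\prec\frac{1+Az}{1+Bz}\quad(z\in\mathbb{U}).$$ All powers are principal values.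
   Formalization: Adds the hypotheses that μ ≠ 0 and that the displayed integrals converge for every ζ in U (equivalently Re(p(α+iβ)/(μn)) > 0); for other μ the exponent is undefined or the integral at ζ = 0 diverges, so the bounds have no meaning. *)

theory Defs
  imports "HOL-Complex_Analysis.Complex_Analysis" "HOL-Library.Extended_Real"
begin

abbreviation unit_disc :: "complex set"
  where "unit_disc \<equiv> ball 0 1"

text \<open>
  Roots are counted with multiplicity. The finiteness conjunct is needed because a sum over an
  infinite set is 0; it also excludes constant functions, for which \<^const>\<open>zorder\<close> is meaningless.
\<close>
definition p_valent :: "nat \<Rightarrow> (complex \<Rightarrow> complex) \<Rightarrow> complex set \<Rightarrow> bool"
  where "p_valent p f S \<longleftrightarrow>
    (\<forall>v. finite {z \<in> S. f z = v} \<and>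
         (\<Sum>z | z \<in> S \<and> f z = v. zorder (\<lambda>x. f x - v) z) \<le> int p) \<and>
    (\<exists>v. (\<Sum>z | z \<in> S \<and> f z = v. zorder (\<lambda>x. f x - v) z) = int p)"

text \<open>The class usually written $\mathcal{A}_p$; the dependence on $n$ is made explicit here.\<close>
definition class_A :: "nat \<Rightarrow> nat \<Rightarrow> (complex \<Rightarrow> complex) set"
  where "class_A p n = {f. f holomorphic_on unit_disc \<and>
    (\<exists>a :: nat \<Rightarrow> complex. \<forall>z\<in>unit_disc.
       (\<lambda>k. a (n + k + p) * z ^ (n + k + p)) sums (f z - z ^ p)) \<and>
    p_valent p f unit_disc}"

definition subordinate :: "(complex \<Rightarrow> complex) \<Rightarrow> (complex \<Rightarrow> complex) \<Rightarrow> bool"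
  where "subordinate F G \<longleftrightarrow>
    F holomorphic_on unit_disc \<and> G holomorphic_on unit_disc \<and>
    (\<exists>w. w holomorphic_on unit_disc \<and> w 0 = 0 \<and> (\<forall>z\<in>unit_disc. norm (w z) < 1) \<and>
         (\<forall>z\<in>unit_disc. F z = G (w z)))"

text \<open>
  The quotients $z^p/f(z)$ and $z f'(z)/(p f(z))$ both have a removable singularity at 0 with
  value 1 there when $f$ belongs to the class above.
\<close>
definition power_quot :: "nat \<Rightarrow> (complex \<Rightarrow> complex) \<Rightarrow> complex \<Rightarrow> complex"
  where "power_quot p f z = (if z = 0 then 1 else z ^ p / f z)"

definition log_deriv_quot :: "nat \<Rightarrow> (complex \<Rightarrow> complex) \<Rightarrow> complex \<Rightarrow> complex"
  where "log_deriv_quot p f z = (if z = 0 then 1 else z * deriv f z / (of_nat p * f z))"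

definition moebius_AB :: "real \<Rightarrow> real \<Rightarrow> complex \<Rightarrow> complex"
  where "moebius_AB A B z = (1 + of_real A * z) / (1 + of_real B * z)"

definition class_N ::
    "nat \<Rightarrow> nat \<Rightarrow> complex \<Rightarrow> real \<Rightarrow> real \<Rightarrow> real \<Rightarrow> real \<Rightarrow> (complex \<Rightarrow> complex) set"
  where "class_N p n \<mu> \<alpha> \<beta> A B = {f \<in> class_A p n.
    subordinate
      (\<lambda>z. (1 + \<mu>) * power_quot p f z powr (of_real \<alpha> + \<i> * of_real \<beta>)
            - \<mu> * log_deriv_quot p f z * power_quot p f z powr (of_real \<alpha> + \<i> * of_real \<beta>))
      (moebius_AB A B)}"

definition bound_exponent :: "nat \<Rightarrow> nat \<Rightarrow> complex \<Rightarrow> real \<Rightarrow> real \<Rightarrow> complex"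
  where "bound_exponent p n \<mu> \<alpha> \<beta> = of_nat p * (of_real \<alpha> + \<i> * of_real \<beta>) / (\<mu> * of_nat n)"

definition bound_integrand :: "complex \<Rightarrow> real \<Rightarrow> real \<Rightarrow> complex \<Rightarrow> real \<Rightarrow> complex"
  where "bound_integrand c A B \<zeta> u =
    moebius_AB A B (\<zeta> * of_real u) * of_real u powr (c - 1)"

definition bound_fun :: "complex \<Rightarrow> real \<Rightarrow> real \<Rightarrow> complex \<Rightarrow> complex"
  where "bound_fun c A B \<zeta> = c * integral {0..1} (bound_integrand c A B \<zeta>)"

end

theory Submission imports Defs begin

text \<open>
  Put \<open>c = p(\<alpha> + i\<beta>)/(\<mu>n)\<close> and \<open>G z = (1 + A z)/(1 + B z)\<close>. Convergence of the integral at \<open>\<zeta> = 0\<close>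
  forces \<open>Re c > 0\<close>. The function \<open>g = (z^p/f)^(\<alpha> + i\<beta>)\<close> is analytic and satisfies
  \<open>g + z g'/(c n) = G \<circ> w\<close> with \<open>norm (w z) \<le> norm z ^ n\<close>, while the integral \<open>Q\<close> satisfies
  \<open>Q + z Q'/c = G\<close>. The quotient \<open>Q'/(c G')\<close> has positive real part, so \<open>Q\<close> is univalent because
  \<open>G\<close> maps onto a convex domain, and a first-contact argument shows that \<open>Q\<^sup>-\<^sup>1 \<circ> g\<close> is bounded by
  \<open>norm z ^ n\<close>. Hence \<open>g\<close> takes its values in the open set \<open>Q ` unit_disc\<close>, which gives both strict
  inequalities.
\<close>

subsection \<open>Euler equations and boundary extrema\<close>

text \<open>The principal power jumps across the negative axis, and \<open>z^p/f\<close> is only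
  known to avoid 0, so analyticity of its power is not automatic. It is extracted from the
  subordination: with \<open>L\<close> the analytic logarithm of \<open>z^p/f\<close>, the
  subordinate function is \<open>1 + \<mu> z L'/p\<close> times the principal power, and this
  product is analytic as a whole. The \<open>n\<close> in \<open>c n\<close> reflects an order of
  vanishing: \<open>g - 1\<close> is divisible by \<open>z^n\<close>, hence so is the pullback of
  \<open>g\<close> under \<open>Q\<close>, and applying \<open>z d/dz\<close> to \<open>z^n\<close>
  returns a factor \<open>n\<close> that cancels the one in \<open>c n\<close>. That pullback exists
  only where \<open>g\<close> takes values in the image of \<open>Q\<close>, which is the very
  claim. The estimate is therefore made on discs where the inclusion already holds, and the gap
  between \<open>norm z ^ n\<close> and 1 is what lets the inclusion pass to the boundary
  circle.\<close>

lemma euler_ode_solution: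
  fixes a :: complex and h :: "complex \<Rightarrow> complex"
  assumes h: "h holomorphic_on ball 0 r" and a: "Re a > 0"
  obtains y where "y holomorphic_on ball 0 r"
    and "\<And>z. z \<in> ball 0 r \<Longrightarrow> a * y z + z * deriv y z = h z"
proof -
  define b where "b k = (deriv ^^ k) h 0 / fact k" for k
  \<comment> \<open>Comparing coefficients of \<open>z^k\<close> gives
    \<open>(a + k) e k = b k\<close>. As \<open>Re a > 0\<close>, every divisor has modulus at least
    \<open>Re a\<close>, so absolute convergence carries over from \<open>b\<close> to
    \<open>e\<close>.\<close>
  define e where "e k = b k / (a + of_nat k)" for k
  define y where "y = (\<lambda>z. \<Sum>k. e k * z ^ k)"
  have b_sums: "(\<lambda>k. b k * z ^ k) sums h z" if "norm z < r" for z
    using holomorphic_power_series[OF h, of z] that by (simp add: b_def)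
  have Re_le: "Re a \<le> norm (a + of_nat k)" for k
    using complex_Re_le_cmod[of "a + of_nat k"] by simp
  have nz: "a + of_nat k \<noteq> 0" for k
    using Re_le[of k] a by auto
  have e_summable: "summable (\<lambda>k. e k * z ^ k)" if z: "norm z < r" for z
  proof -
    \<comment> \<open>Convergence at a point of larger modulus, here halfway to \<open>r\<close>,
      makes the series at \<open>z\<close> absolutely convergent.\<close>
    define x where "x = complex_of_real ((norm z + r) / 2)"
    have "0 \<le> norm z + r" using z norm_ge_zero[of z] by linarith
    then have "norm x = (norm z + r) / 2"
      unfolding x_def norm_of_real by simp
    then have x: "norm z < norm x" "norm x < r" using z by auto
    have "summable (\<lambda>k. norm (b k * z ^ k))"
      using powser_insidea[OF sums_summable[OF b_sums[OF x(2)]] x(1)] .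
    then have "summable (\<lambda>k. norm (b k * z ^ k) / Re a)"
      by (rule summable_divide)
    then show ?thesis
    proof (rule summable_comparison_test')
      fix k
      have "norm (e k * z ^ k) = norm (b k * z ^ k) / norm (a + of_nat k)"
        by (simp add: e_def norm_mult norm_divide)
      also have "\<dots> \<le> norm (b k * z ^ k) / Re a"
        using Re_le[of k] a by (intro divide_left_mono mult_pos_pos) auto
      finally show "norm (e k * z ^ k) \<le> norm (b k * z ^ k) / Re a" .
    qed
  qed
  have der: "(y has_field_derivative (\<Sum>k. diffs e k * z ^ k)) (at z)" if "norm z < r" for z
    unfolding y_def using e_summable that by (rule termdiffs_strong')
  show ?thesis
  proof
    show "y holomorphic_on ball 0 r"
      by (rule holomorphic_onI) (use der in \<open>auto simp: field_differentiable_def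
          intro: has_field_derivative_at_within\<close>)
    fix z :: complex assume "z \<in> ball 0 r"
    then have z: "norm z < r" by simp
    have "summable (\<lambda>k. diffs e k * z ^ k)"
      using z e_summable by (rule termdiff_converges)
    from sums_mult[OF diffs_equiv[OF this], of z]
    have "(\<lambda>k. z * (of_nat k * e k * z ^ (k - Suc 0))) sums (z * deriv y z)"
      by (simp add: DERIV_imp_deriv[OF der[OF z]])
    moreover have "z * (of_nat k * e k * z ^ (k - Suc 0)) = of_nat k * e k * z ^ k" for k
      by (cases k) auto
    ultimately have "(\<lambda>k. of_nat k * e k * z ^ k) sums (z * deriv y z)" by simp
    moreover have "(\<lambda>k. a * (e k * z ^ k)) sums (a * y z)"
      unfolding y_def by (intro sums_mult summable_sums e_summable z)
    ultimately have "(\<lambda>k. a * (e k * z ^ k) + of_nat k * e k * z ^ k)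
        sums (a * y z + z * deriv y z)"
      by (intro sums_add)
    moreover have "a * (e k * z ^ k) + of_nat k * e k * z ^ k = b k * z ^ k" for k
    proof -
      have "a * (e k * z ^ k) + of_nat k * e k * z ^ k = ((a + of_nat k) * e k) * z ^ k"
        by (simp add: algebra_simps)
      also have "(a + of_nat k) * e k = b k" using nz[of k] by (simp add: e_def)
      finally show ?thesis .
    qed
    ultimately show "a * y z + z * deriv y z = h z"
      using b_sums[OF z] sums_unique2 by simp
  qed
qed

text \<open>Along the circle \<open>z0 exp (\<i> t)\<close> the derivative of \<open>Re h\<close> is
  \<open>- Im (z0 h'(z0))\<close>, and it vanishes at a two-sided maximum. Along the radius only
  inner points compete, so the derivative \<open>Re (z0 h'(z0))\<close> is merely
  nonnegative.\<close>

lemma mult_deriv_at_Re_max: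
  fixes h :: "complex \<Rightarrow> complex"
  assumes h: "h holomorphic_on S" "open S" and sub: "cball 0 (norm z0) \<subseteq> S"
    and max: "\<And>z. norm z \<le> norm z0 \<Longrightarrow> Re (h z) \<le> Re (h z0)"
  shows "Im (z0 * deriv h z0) = 0" and "Re (z0 * deriv h z0) \<ge> 0"
proof -
  have "z0 \<in> S" using sub by auto
  then have der: "(h has_field_derivative deriv h z0) (at z0)"
    using h by (rule holomorphic_derivI[rotated 2])
  have "((\<lambda>t. z0 * exp (\<i> * of_real t)) has_vector_derivative z0 * \<i>) (at 0)"
    by (auto intro!: derivative_eq_intros has_vector_derivative_real_field)
  then have "(h \<circ> (\<lambda>t. z0 * exp (\<i> * of_real t)) has_vector_derivative
      (z0 * \<i>) * deriv h z0) (at 0)"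
    by (rule field_vector_diff_chain_at) (use der in simp)
  from bounded_linear.has_vector_derivative[OF bounded_linear_Re this]
  have "((\<lambda>t. Re (h (z0 * exp (\<i> * of_real t)))) has_real_derivative - Im (z0 * deriv h z0)) (at 0)"
    by (simp add: has_real_derivative_iff_has_vector_derivative o_def algebra_simps)
  then have "- Im (z0 * deriv h z0) = 0"
    by (rule DERIV_local_max[where d = 1]) (auto intro!: max simp: norm_mult)
  then show "Im (z0 * deriv h z0) = 0" by simp
  have "((\<lambda>t. of_real t * z0) has_vector_derivative z0) (at 1)"
    by (auto intro!: derivative_eq_intros has_vector_derivative_real_field)
  then have "(h \<circ> (\<lambda>t. of_real t * z0) has_vector_derivative z0 * deriv h z0) (at 1)"
    by (rule field_vector_diff_chain_at) (use der in simp)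
  from bounded_linear.has_vector_derivative[OF bounded_linear_Re this]
  have rad: "((\<lambda>t. Re (h (of_real t * z0))) has_real_derivative Re (z0 * deriv h z0)) (at 1)"
    by (simp add: has_real_derivative_iff_has_vector_derivative o_def)
  show "Re (z0 * deriv h z0) \<ge> 0"
  proof (rule ccontr)
    assume "\<not> ?thesis"
    then obtain d where d: "d > 0"
      "\<And>s. s > 0 \<Longrightarrow> s < d \<Longrightarrow> Re (h (of_real 1 * z0)) < Re (h (of_real (1 - s) * z0))"
      using has_real_derivative_neg_dec_left[OF rad] by auto
    \<comment> \<open>The cap 1/2 keeps \<open>1 - s\<close> between 0 and 1, so the comparison
      point stays in the disc.\<close>
    define s where "s = min (d / 2) (1 / 2)"
    have "norm (of_real (1 - s) * z0) \<le> norm z0"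
      unfolding norm_mult norm_of_real using d(1)
      by (intro mult_left_le_one_le) (auto simp: s_def)
    moreover have "s > 0" "s < d" using d(1) by (auto simp: s_def)
    ultimately show False using max[of "of_real (1 - s) * z0"] d(2)[of s] by simp
  qed
qed

text \<open>At a point where \<open>Re N\<close> reaches its minimum \<open>\<le> 0\<close> over a disc, \<open>z N'(z)\<close> is real and
  nonpositive, so \<open>P = (1 - z N') / N\<close> would have nonpositive real part.\<close>
lemma Re_pos_if_euler_ode:
  fixes N P :: "complex \<Rightarrow> complex"
  assumes N: "N holomorphic_on ball 0 r"
    and ode: "\<And>z. z \<in> ball 0 r \<Longrightarrow> z * deriv N z + P z * N z = 1"
    and P: "\<And>z. z \<in> ball 0 r \<Longrightarrow> Re (P z) > 0"
    and z1: "z1 \<in> ball 0 r"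
  shows "Re (N z1) > 0"
proof (rule ccontr)
  assume neg: "\<not> ?thesis"
  have sub: "cball 0 (norm z1) \<subseteq> ball 0 r" using z1 by auto
  have "continuous_on (cball 0 (norm z1)) (\<lambda>z. Re (N z))"
    using holomorphic_on_imp_continuous_on[OF N] sub
    by (intro continuous_intros) (auto intro: continuous_on_subset)
  then obtain z0 where z0: "z0 \<in> cball 0 (norm z1)"
    and min: "\<And>z. z \<in> cball 0 (norm z1) \<Longrightarrow> Re (N z0) \<le> Re (N z)"
    using continuous_attains_inf[of "cball 0 (norm z1)" "\<lambda>z. Re (N z)"] by auto
  have z0r: "z0 \<in> ball 0 r" using z0 sub by blast
  have le0: "Re (N z0) \<le> 0" using min[of z1] neg by auto
  have dN: "deriv (\<lambda>z. - N z) z0 = - deriv N z0"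
    using holomorphic_on_imp_differentiable_at[OF N _ z0r] by simp
  note mm = mult_deriv_at_Re_max[of "\<lambda>z. - N z" "ball 0 r" z0]
  have 1: "(\<lambda>z. - N z) holomorphic_on ball 0 r" using N by (intro holomorphic_intros)
  have 2: "cball 0 (norm z0) \<subseteq> ball 0 r" using z0r by auto
  have 3: "Re (- N z) \<le> Re (- N z0)" if "norm z \<le> norm z0" for z
    using min[of z] that z0 by auto
  have m: "Im (z0 * deriv N z0) = 0" "Re (z0 * deriv N z0) \<le> 0"
    using mm[OF 1 _ 2 3] by (simp_all add: dN)
  then obtain s where s: "z0 * deriv N z0 = of_real s" "s \<le> 0"
    by (metis complex_is_Real_iff of_real_Re)
  have PN: "P z0 * N z0 = of_real (1 - s)" using ode[OF z0r] s by (simp add: algebra_simps)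
  then have "N z0 \<noteq> 0" using s by (auto simp del: of_real_diff)
  then have "P z0 = of_real (1 - s) / N z0" using PN by (simp add: field_simps)
  then have "Re (P z0) = (1 - s) * Re (N z0) / ((Re (N z0))\<^sup>2 + (Im (N z0))\<^sup>2)"
    by (simp add: Re_divide)
  also have "\<dots> \<le> 0"
    using le0 s by (intro divide_nonpos_nonneg mult_nonneg_nonpos) auto
  finally show False using P[OF z0r] by simp
qed

text \<open>By the product rule \<open>(z^n y)' = z^(n-1) (n y + z y')\<close>, so a solution of the
  Euler equation \<open>n y + z y' = k\<close> makes \<open>z^n y\<close> a primitive of
  \<open>g'\<close> vanishing at 0.\<close>

lemma diff_eq_power_mult:
  assumes n: "n \<ge> 1" and g: "g holomorphic_on ball 0 r" and k: "k holomorphic_on ball 0 r"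
    and dg: "\<And>z. z \<in> ball 0 r \<Longrightarrow> deriv g z = z ^ (n - 1) * k z"
  obtains y where "y holomorphic_on ball 0 r"
    and "\<And>z. z \<in> ball 0 r \<Longrightarrow> g z - g 0 = z ^ n * y z"
proof -
  obtain y where y: "y holomorphic_on ball 0 r"
    and ode: "\<And>z. z \<in> ball 0 r \<Longrightarrow> of_nat n * y z + z * deriv y z = k z"
    using euler_ode_solution[OF k, of "of_nat n"] n by auto
  define u where "u z = g z - z ^ n * y z" for z
  have "(u has_field_derivative 0) (at z within ball 0 r)" if z: "z \<in> ball 0 r" for z
  proof -
    have "(u has_field_derivative
        deriv g z - (of_nat n * z ^ (n - 1) * y z + z ^ n * deriv y z)) (at z)"
      unfolding u_def
      using holomorphic_derivI[OF g open_ball z] holomorphic_derivI[OF y open_ball z]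
      by (auto intro!: derivative_eq_intros)
    also have "z ^ n = z ^ (n - 1) * z" using n by (simp flip: power_Suc2)
    also have "deriv g z - (of_nat n * z ^ (n - 1) * y z + z ^ (n - 1) * z * deriv y z) = 0"
      unfolding dg[OF z] ode[OF z, symmetric] by algebra
    finally show ?thesis by (rule has_field_derivative_at_within)
  qed
  then obtain C where C: "\<And>z. z \<in> ball 0 r \<Longrightarrow> u z = C"
    using has_field_derivative_zero_constant[OF convex_ball] by blast
  have "g z - g 0 = z ^ n * y z" if "z \<in> ball 0 r" for z
  proof -
    have "0 \<in> ball 0 r" using that norm_ge_zero[of z] by (auto simp del: norm_ge_zero)
    then have "u z = u 0" using C that by simp
    then show ?thesis using n by (auto simp: u_def power_0_left algebra_simps)
  qed
  then show ?thesis using y that by blast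
qed

text \<open>Noshiro-Warschawski criterion: along the segment from \<open>a\<close> to
  \<open>b\<close> the function \<open>Re (H / (b - a))\<close> has derivative \<open>Re H'\<close>,
  hence increases strictly.\<close>

lemma inj_on_if_Re_deriv_pos:
  fixes H :: "complex \<Rightarrow> complex"
  assumes "convex S" "open S" "H holomorphic_on S"
    and pos: "\<And>z. z \<in> S \<Longrightarrow> Re (deriv H z) > 0"
  shows "inj_on H S"
proof (rule inj_onI, rule ccontr)
  fix a b assume ab: "a \<in> S" "b \<in> S" "H a = H b" "a \<noteq> b"
  define l where "l t = a + of_real t * (b - a)" for t :: real
  have l: "l t \<in> S" if "0 \<le> t" "t \<le> 1" for t
  proof -
    have "(1 - t) *\<^sub>R a + t *\<^sub>R b \<in> S"
      using that ab \<open>convex S\<close> by (intro convexD) auto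
    then show ?thesis by (simp add: l_def scaleR_conv_of_real algebra_simps)
  qed
  have "\<exists>y. ((\<lambda>t. Re (H (l t) / (b - a))) has_real_derivative y) (at t) \<and> y > 0"
    if t: "0 \<le> t" "t \<le> 1" for t
  proof -
    have "(l has_vector_derivative (b - a)) (at t)"
      unfolding l_def by (auto intro!: derivative_eq_intros has_vector_derivative_real_field)
    then have "(H \<circ> l has_vector_derivative (b - a) * deriv H (l t)) (at t)"
      by (rule field_vector_diff_chain_at)
        (use holomorphic_derivI[OF assms(3,2) l[OF t]] in simp)
    then have "((\<lambda>t. H (l t) / (b - a)) has_vector_derivative
        (b - a) * deriv H (l t) / (b - a)) (at t)"
      unfolding o_def by (rule has_vector_derivative_divide)
    from bounded_linear.has_vector_derivative[OF bounded_linear_Re this]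
    show ?thesis using ab pos[OF l[OF t]]
      by (auto simp: has_real_derivative_iff_has_vector_derivative)
  qed
  then have "Re (H (l 0) / (b - a)) < Re (H (l 1) / (b - a))"
    by (rule DERIV_pos_imp_increasing[OF zero_less_one])
  then show False using ab by (simp add: l_def)
qed

subsection \<open>Moebius transformations of the disc\<close>

text \<open>After multiplication by the conjugate denominator, the real part only decreases when
  \<open>Re q\<close> is replaced by \<open>k = norm q\<close> and \<open>Re a\<close> by
  \<open>- s = - norm a\<close>; the result factors as \<open>(1 - s) (1 - k) (1 - k s)\<close>. The
  expression is a normalised difference of Moebius values, with \<open>q = w / v\<close> and
  \<open>a = B v\<close>.\<close>

lemma Re_one_minus_ratio_pos:
  fixes a q :: complex
  assumes "norm q < 1" and "norm a < 1"
  shows "Re ((1 - q) * (1 + a) / (1 + a * q)) > 0"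
proof -
  define k s where "k = norm q" and "s = norm a"
  have k: "0 \<le> k" "k < 1" "Re q \<le> k" and s: "0 \<le> s" "s < 1" "- s \<le> Re a"
    using assms complex_Re_le_cmod[of q] abs_Re_le_cmod[of a] by (auto simp: k_def s_def)
  have "norm (a * q) < 1 * 1"
    unfolding norm_mult using assms by (intro mult_strict_mono') auto
  then have nz: "1 + a * q \<noteq> 0"
    by (metis add_eq_0_iff mult_1 norm_minus_cancel norm_one order_less_irrefl)
  have "Re ((1 - q) * (1 + a) * cnj (1 + a * q))
      = (1 - Re q) * (1 - s\<^sup>2) + (1 - k\<^sup>2) * (Re a + s\<^sup>2)"
    unfolding k_def s_def cmod_power2 by simp algebra
  also have "\<dots> \<ge> (1 - k) * (1 - s\<^sup>2) + (1 - k\<^sup>2) * (- s + s\<^sup>2)"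
    using k s by (intro add_mono mult_mono mult_left_mono mult_right_mono)
      (auto simp: power_le_one)
  also have "(1 - k) * (1 - s\<^sup>2) + (1 - k\<^sup>2) * (- s + s\<^sup>2) = (1 - s) * (1 - k) * (1 - k * s)"
    by algebra
  moreover have "k * s < 1 * 1" using k s by (intro mult_strict_mono') auto
  then have "(1 - s) * (1 - k) * (1 - k * s) > 0" using k s by simp
  ultimately have "Re ((1 - q) * (1 + a) * cnj (1 + a * q)) > 0" by linarith
  then have "Re ((1 - q) * (1 + a) * cnj (1 + a * q)) / (norm (1 + a * q))\<^sup>2 > 0"
    using nz by simp
  moreover have "(1 - q) * (1 + a) / (1 + a * q)
      = (1 - q) * (1 + a) * cnj (1 + a * q) / of_real ((norm (1 + a * q))\<^sup>2)"
    by (subst complex_div_cnj) simp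
  ultimately show ?thesis by (simp only: Re_divide_of_real)
qed

lemma one_plus_mult_nonzero:
  fixes B :: real and z :: complex
  assumes "\<bar>B\<bar> \<le> 1" "norm z < 1"
  shows "1 + of_real B * z \<noteq> 0"
proof -
  have "norm (of_real B * z) \<le> 1 * norm z"
    unfolding norm_mult norm_of_real using assms by (intro mult_right_mono) auto
  then show ?thesis using assms(2)
    by (metis add_eq_0_iff mult_1 norm_minus_cancel norm_one not_less)
qed

lemma moebius_AB_has_field_derivative:
  assumes "\<bar>B\<bar> \<le> 1" "norm z < 1"
  shows "(moebius_AB A B has_field_derivative of_real (A - B) / (1 + of_real B * z)\<^sup>2) (at z)"
  unfolding moebius_AB_def using one_plus_mult_nonzero[OF assms]
  by (auto intro!: derivative_eq_intros simp: field_simps power2_eq_square)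

lemma moebius_AB_holomorphic:
  assumes "\<bar>B\<bar> \<le> 1"
  shows "moebius_AB A B holomorphic_on unit_disc"
  unfolding moebius_AB_def using one_plus_mult_nonzero[OF assms]
  by (intro holomorphic_intros) auto

text \<open>These identities invert the transformation: \<open>y = G z\<close> is solved by
  \<open>z = (y - 1) / (A - B y)\<close>, whose denominator is nonzero by the first one. The second
  also transfers a factor \<open>z^n\<close> from \<open>G (w z) - 1\<close> to
  \<open>w z\<close>.\<close>

lemma moebius_AB_solve:
  assumes "\<bar>B\<bar> \<le> 1" "A \<noteq> B" "norm z < 1"
  shows "of_real A - of_real B * moebius_AB A B z = of_real (A - B) / (1 + of_real B * z)"
    and "moebius_AB A B z - 1 = z * (of_real A - of_real B * moebius_AB A B z)"
  unfolding moebius_AB_def using one_plus_mult_nonzero[OF assms(1,3)]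
  by (simp_all add: field_simps)

text \<open>The inequality says that the preimage \<open>(y - 1) / (A - B y)\<close> has modulus
  below 1. It covers discs and, for \<open>B = 1\<close> or \<open>B = -1\<close>, half-planes
  without a case distinction.\<close>

lemma moebius_AB_image:
  assumes "\<bar>B\<bar> \<le> 1" "A \<noteq> B"
  shows "moebius_AB A B ` unit_disc = {y. norm (y - 1) < norm (of_real A - of_real B * y)}"
proof (intro equalityI subsetI)
  fix y assume "y \<in> moebius_AB A B ` unit_disc"
  then obtain z where z: "norm z < 1" "y = moebius_AB A B z" by auto
  note s = moebius_AB_solve[OF assms z(1)]
  have "of_real A - of_real B * y \<noteq> 0"
    unfolding z(2) s(1) using one_plus_mult_nonzero[OF assms(1) z(1)] assms(2) by simp
  then have "norm z * norm (of_real A - of_real B * y) < 1 * norm (of_real A - of_real B * y)"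
    using z(1) by (intro mult_strict_right_mono) auto
  then show "y \<in> {y. norm (y - 1) < norm (of_real A - of_real B * y)}"
    using s(2) z(2) by (simp add: norm_mult)
next
  fix y :: complex assume "y \<in> {y. norm (y - 1) < norm (of_real A - of_real B * y)}"
  then have y: "norm (y - 1) < norm (of_real A - of_real B * y)" by simp
  then have nz: "of_real A - of_real B * y \<noteq> 0" by auto
  define z where "z = (y - 1) / (of_real A - of_real B * y)"
  have z: "norm z < 1" using y nz by (simp add: z_def norm_divide)
  have "1 + of_real A * z = y * of_real (A - B) / (of_real A - of_real B * y)"
    "1 + of_real B * z = of_real (A - B) / (of_real A - of_real B * y)"
    using nz by (simp_all add: z_def field_simps)
  then have "moebius_AB A B z = y"
    using nz assms(2) by (simp add: moebius_AB_def)
  then show "y \<in> moebius_AB A B ` unit_disc" using z by force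
qed

lemma convex_moebius_AB_image:
  assumes "\<bar>B\<bar> \<le> 1" "A \<noteq> B"
  shows "convex (moebius_AB A B ` unit_disc)"
proof -
  define \<phi> where "\<phi> y = (norm (y - 1))\<^sup>2 - (norm (of_real A - of_real B * y))\<^sup>2" for y :: complex
  have iff: "norm (y - 1) < norm (of_real A - of_real B * y) \<longleftrightarrow> \<phi> y < 0" for y :: complex
  proof -
    have "norm (of_real A - of_real B * y) \<le> norm (y - 1) \<longleftrightarrow>
        (norm (of_real A - of_real B * y))\<^sup>2 \<le> (norm (y - 1))\<^sup>2"
      by (simp add: power_mono_iff)
    then show ?thesis unfolding \<phi>_def by linarith
  qed
  \<comment> \<open>The quadratic part of \<open>\<phi>\<close> is \<open>1 - B^2\<close> times the
    squared norm, so this is its exact convexity defect; \<open>B^2 \<le> 1\<close> gives it the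
    right sign.\<close>
  have eq: "\<phi> (u *\<^sub>R x + v *\<^sub>R y) = u * \<phi> x + v * \<phi> y - u * v * (1 - B\<^sup>2) * (norm (x - y))\<^sup>2"
    if "u + v = 1" for x y :: complex and u v :: real
  proof -
    have v: "v = 1 - u" using that by simp
    show ?thesis unfolding \<phi>_def cmod_power2 v by simp algebra
  qed
  have "B\<^sup>2 \<le> 1" using assms(1) by (simp add: abs_square_le_1)
  then have "\<phi> (u *\<^sub>R x + v *\<^sub>R y) < 0"
    if "\<phi> x < 0" "\<phi> y < 0" "u \<ge> 0" "v \<ge> 0" "u + v = 1" for x y :: complex and u v :: real
  proof -
    have "u * \<phi> x + v * \<phi> y < 0" using that by (intro convex_bound_lt)
    moreover have "u * v * (1 - B\<^sup>2) * (norm (x - y))\<^sup>2 \<ge> 0"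
      using that \<open>B\<^sup>2 \<le> 1\<close> by simp
    ultimately show ?thesis using eq[of u v x y] that by linarith
  qed
  then show ?thesis unfolding moebius_AB_image[OF assms] iff by (auto intro!: convexI)
qed

text \<open>\<open>moebius_AB A B\<close> maps the disc \<open>norm z < norm v\<close> to a disc with outer normal
  \<open>v G'(v)\<close> at \<open>G v\<close>.\<close>
lemma moebius_AB_outer_normal:
  assumes B: "\<bar>B\<bar> \<le> 1" "A \<noteq> B" and wv: "norm w < norm v" "norm v < 1" and X: "Re X \<ge> 0"
  shows "moebius_AB A B w
    \<noteq> moebius_AB A B v + X * (v * (of_real (A - B) / (1 + of_real B * v)\<^sup>2))"
proof
  assume eq: "moebius_AB A B w
    = moebius_AB A B v + X * (v * (of_real (A - B) / (1 + of_real B * v)\<^sup>2))"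
  define q a where "q = w / v" and "a = of_real B * v"
  have v0: "v \<noteq> 0" using wv by auto
  have w: "w = q * v" and aq: "of_real B * w = a * q"
    using v0 by (simp_all add: q_def a_def)
  have "1 + of_real B * v \<noteq> 0" "1 + of_real B * w \<noteq> 0"
    using wv by (simp_all add: one_plus_mult_nonzero[OF B(1)])
  then have nz: "1 + a \<noteq> 0" "1 + a * q \<noteq> 0"
    unfolding aq a_def[symmetric] by simp_all
  have "norm q < 1" using wv v0 by (simp add: q_def norm_divide)
  moreover have "norm a < 1"
    unfolding a_def norm_mult norm_of_real
    using B wv mult_left_le_one_le[of "norm v" "\<bar>B\<bar>"] by simp
  ultimately have pos: "Re ((1 - q) * (1 + a) / (1 + a * q)) > 0"
    by (rule Re_one_minus_ratio_pos)
  have "X * v * of_real (A - B) / (1 + a)\<^sup>2 = moebius_AB A B w - moebius_AB A B v"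
    using eq by (simp add: a_def)
  \<comment> \<open>Since \<open>w - v = - (1 - q) v\<close>, pulling \<open>v G'(v)\<close> out of
    this difference leaves minus the quotient of positive real part, and \<open>X\<close> must equal
    it.\<close>
  also have "\<dots> = of_real (A - B) * (w - v) / ((1 + a * q) * (1 + a))"
    unfolding moebius_AB_def aq a_def[symmetric] using nz
    by (simp add: divide_simps) (simp add: a_def w algebra_simps)
  also have "\<dots> = of_real (A - B) * v / (1 + a)\<^sup>2 * (- ((1 - q) * (1 + a) / (1 + a * q)))"
    using nz by (simp add: w divide_simps power2_eq_square) (simp add: algebra_simps)
  finally have "of_real (A - B) * v / (1 + a)\<^sup>2 * X
      = of_real (A - B) * v / (1 + a)\<^sup>2 * (- ((1 - q) * (1 + a) / (1 + a * q)))"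
    by (simp add: mult_ac)
  moreover have "of_real (A - B) * v / (1 + a)\<^sup>2 \<noteq> 0"
    using v0 nz B by simp
  ultimately have "X = - ((1 - q) * (1 + a) / (1 + a * q))"
    by (metis mult_left_cancel)
  then show False using pos X by simp
qed

subsection \<open>The dominant\<close>

text \<open>The dominant \<open>Q\<close>; the quotient \<open>N = Q' / (c G')\<close>, with \<open>G = moebius_AB A B\<close>, satisfies
  \<open>z N' + (c + (1 - B z) / (1 + B z)) N = 1\<close>.\<close>
lemma moebius_dominant:
  assumes c: "Re c > 0" and B: "\<bar>B\<bar> \<le> 1" "A \<noteq> B"
  obtains Q N where "Q holomorphic_on unit_disc"
    and "\<And>z. z \<in> unit_disc \<Longrightarrow> Q z + z * deriv Q z / c = moebius_AB A B z"
    and "\<And>z. z \<in> unit_disc \<Longrightarrow>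
      deriv Q z = c * N z * (of_real (A - B) / (1 + of_real B * z)\<^sup>2)"
    and "\<And>z. z \<in> unit_disc \<Longrightarrow> Re (N z) > 0"
proof -
  have c0: "c \<noteq> 0" using c by auto
  have "(\<lambda>z. c * moebius_AB A B z) holomorphic_on unit_disc"
    by (intro holomorphic_intros moebius_AB_holomorphic B)
  then obtain Q where Q: "Q holomorphic_on unit_disc"
    and ode: "\<And>z. z \<in> unit_disc \<Longrightarrow> c * Q z + z * deriv Q z = c * moebius_AB A B z"
    using euler_ode_solution[OF _ c] by blast
  define k where "k = c * of_real (A - B)"
  have k0: "k \<noteq> 0" using c0 B by (simp add: k_def)
  define N where "N = (\<lambda>z. deriv Q z * (1 + of_real B * z)\<^sup>2 / k)"
  \<comment> \<open>Differentiating the Euler equation of \<open>Q\<close> contributes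
    \<open>c + 1\<close>, and differentiating the factor \<open>(1 + B z)^2\<close> of
    \<open>N\<close> subtracts \<open>2 B z / (1 + B z)\<close>; note that
    \<open>1 - 2 B z / (1 + B z) = (1 - B z) / (1 + B z)\<close>.\<close>
  define P where "P z = c + (1 - of_real B * z) / (1 + of_real B * z)" for z
  have dQ: "deriv Q holomorphic_on unit_disc"
    using Q by (intro holomorphic_deriv) auto
  have nz: "1 + of_real B * z \<noteq> 0" if "z \<in> unit_disc" for z
    using one_plus_mult_nonzero[OF B(1)] that by simp
  have N: "N holomorphic_on unit_disc"
    unfolding N_def by (intro holomorphic_intros dQ k0)
  have P: "Re (P z) > 0" if z: "z \<in> unit_disc" for z
  proof -
    define x where "x = of_real B * z"
    have "norm x < 1" unfolding x_def norm_mult norm_of_real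
      using B z mult_left_le_one_le[of "norm z" "\<bar>B\<bar>"] by simp
    then have "(Re x)\<^sup>2 + (Im x)\<^sup>2 < 1"
      by (metis abs_square_less_1 abs_norm_cancel cmod_power2)
    then have "(1 - Re x) * (1 + Re x) - Im x * Im x \<ge> 0"
      by (simp add: power2_eq_square algebra_simps)
    then have "Re ((1 - x) / (1 + x)) \<ge> 0"
      by (simp add: Re_divide)
    then show ?thesis using c by (simp add: P_def x_def)
  qed
  have odeN: "z * deriv N z + P z * N z = 1" if z: "z \<in> unit_disc" for z
  proof -
    have z1: "norm z < 1" using z by simp
    have "((\<lambda>z. c * Q z + z * deriv Q z) has_field_derivative
        c * deriv Q z + (deriv Q z + z * deriv (deriv Q) z)) (at z)"
      using holomorphic_derivI[OF Q open_ball z] holomorphic_derivI[OF dQ open_ball z]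
      by (auto intro!: derivative_eq_intros)
    then have "((\<lambda>z. c * moebius_AB A B z) has_field_derivative
        c * deriv Q z + (deriv Q z + z * deriv (deriv Q) z)) (at z)"
      by (rule has_field_derivative_transform_within_open[OF _ open_ball z]) (rule ode)
    moreover have "((\<lambda>z. c * moebius_AB A B z) has_field_derivative
        c * (of_real (A - B) / (1 + of_real B * z)\<^sup>2)) (at z)"
      by (intro DERIV_cmult moebius_AB_has_field_derivative B z1)
    ultimately have "c * deriv Q z + (deriv Q z + z * deriv (deriv Q) z)
        = c * (of_real (A - B) / (1 + of_real B * z)\<^sup>2)"
      by (rule DERIV_unique)
    then have d2: "(1 + of_real B * z)\<^sup>2 * (c * deriv Q z + (deriv Q z + z * deriv (deriv Q) z)) = k"
      using nz[OF z] by (simp add: k_def)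
    have "(N has_field_derivative (deriv (deriv Q) z * (1 + of_real B * z)\<^sup>2
        + deriv Q z * (2 * (1 + of_real B * z) * of_real B)) / k) (at z)"
      unfolding N_def using holomorphic_derivI[OF dQ open_ball z] k0
      by (auto intro!: derivative_eq_intros simp: field_simps)
    then have dN: "deriv N z = (deriv (deriv Q) z * (1 + of_real B * z)\<^sup>2
        + deriv Q z * (2 * (1 + of_real B * z) * of_real B)) / k"
      by (rule DERIV_imp_deriv)
    define R where "R = (1 - of_real B * z) / (1 + of_real B * z)"
    have kN: "k * N z = deriv Q z * (1 + of_real B * z)\<^sup>2"
      using k0 by (simp add: N_def)
    have kdN: "k * deriv N z = deriv (deriv Q) z * (1 + of_real B * z)\<^sup>2
        + deriv Q z * (2 * (1 + of_real B * z) * of_real B)"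
      using k0 unfolding dN by simp
    have "R * (deriv Q z * (1 + of_real B * z)\<^sup>2)
        = deriv Q z * ((1 - of_real B * z) * (1 + of_real B * z))"
      using nz[OF z] by (simp add: R_def power2_eq_square)
    moreover have "k * (z * deriv N z + P z * N z)
        = z * (k * deriv N z) + c * (k * N z) + R * (k * N z)"
      unfolding P_def R_def[symmetric] by algebra
    ultimately have "k * (z * deriv N z + P z * N z)
        = z * (deriv (deriv Q) z * (1 + of_real B * z)\<^sup>2
          + deriv Q z * (2 * (1 + of_real B * z) * of_real B))
          + c * (deriv Q z * (1 + of_real B * z)\<^sup>2)
          + deriv Q z * ((1 - of_real B * z) * (1 + of_real B * z))"
      unfolding kN kdN by simp
    also have "\<dots> = (1 + of_real B * z)\<^sup>2 * (c * deriv Q z + (deriv Q z + z * deriv (deriv Q) z))"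
      by algebra
    finally show ?thesis using k0 d2 by simp
  qed
  have "Re (N z) > 0" if "z \<in> unit_disc" for z
    by (rule Re_pos_if_euler_ode[OF N odeN P that])
  moreover have "deriv Q z = c * N z * (of_real (A - B) / (1 + of_real B * z)\<^sup>2)"
    if "z \<in> unit_disc" for z
    using nz[OF that] k0 by (simp add: N_def k_def)
  moreover have "Q z + z * deriv Q z / c = moebius_AB A B z" if "z \<in> unit_disc" for z
    using ode[OF that] c0 by (simp add: field_simps)
  ultimately show ?thesis using Q that by blast
qed

text \<open>This is univalence of close-to-convex functions: \<open>H\<close>, which is
  \<open>Q\<close> composed with the inverse of \<open>G\<close> and divided by \<open>c\<close>,
  has derivative \<open>N z\<close> at \<open>G z\<close>, and it lives on the convex image of
  \<open>G\<close>.\<close>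

lemma inj_on_moebius_dominant:
  assumes B: "\<bar>B\<bar> \<le> 1" "A \<noteq> B" and "c \<noteq> 0" and Q: "Q holomorphic_on unit_disc"
    and dQ: "\<And>z. z \<in> unit_disc \<Longrightarrow>
      deriv Q z = c * N z * (of_real (A - B) / (1 + of_real B * z)\<^sup>2)"
    and N: "\<And>z. z \<in> unit_disc \<Longrightarrow> Re (N z) > 0"
  shows "inj_on Q unit_disc"
proof -
  let ?G = "moebius_AB A B"
  define S where "S = ?G ` unit_disc"
  define Gi where "Gi y = (y - 1) / (of_real A - of_real B * y)" for y :: complex
  define H where "H y = Q (Gi y) / c" for y
  have Gi: "Gi (?G z) = z" if "z \<in> unit_disc" for z
    using moebius_AB_solve[OF B, of z] one_plus_mult_nonzero[OF B(1), of z] that B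
    by (simp add: Gi_def)
  have injG: "inj_on ?G unit_disc" using Gi by (rule inj_on_inverseI)
  have "open S"
    unfolding S_def using moebius_AB_holomorphic[OF B(1)] injG by (intro open_mapping_thm3) auto
  have der: "(H has_field_derivative N z) (at (?G z))" if z: "z \<in> unit_disc" for z
  proof -
    have z1: "norm z < 1" using z by simp
    have nz: "1 + of_real B * z \<noteq> 0" using one_plus_mult_nonzero[OF B(1) z1] .
    note s = moebius_AB_solve[OF B z1]
    have nz2: "of_real A - of_real B * ?G z \<noteq> 0" using s(1) nz B by simp
    have "(Gi has_field_derivative
        ((of_real A - of_real B * ?G z) - (?G z - 1) * (- of_real B))
          / (of_real A - of_real B * ?G z)\<^sup>2) (at (?G z))"
      unfolding Gi_def using nz2 by (auto intro!: derivative_eq_intros simp: power2_eq_square)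
    also have "(of_real A - of_real B * ?G z) - (?G z - 1) * (- of_real B) = of_real (A - B)"
      by (simp add: algebra_simps)
    finally have dGi: "(Gi has_field_derivative
        of_real (A - B) / (of_real A - of_real B * ?G z)\<^sup>2) (at (?G z))" .
    have "(Q has_field_derivative deriv Q z) (at (Gi (?G z)))"
      unfolding Gi[OF z] by (rule holomorphic_derivI[OF Q open_ball z])
    from DERIV_chain2[OF this dGi]
    have "(H has_field_derivative
        deriv Q z * (of_real (A - B) / (of_real A - of_real B * ?G z)\<^sup>2) / c) (at (?G z))"
      unfolding H_def by (rule DERIV_cdivide)
    also have "deriv Q z * (of_real (A - B) / (of_real A - of_real B * ?G z)\<^sup>2) / c = N z"
      unfolding s(1) dQ[OF z] using nz B \<open>c \<noteq> 0\<close>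
      by (simp add: power_divide power2_eq_square divide_simps)
    finally show ?thesis .
  qed
  have "inj_on H S"
  proof (rule inj_on_if_Re_deriv_pos)
    show "convex S" unfolding S_def using B by (rule convex_moebius_AB_image)
    show "open S" by fact
    show "H holomorphic_on S"
    proof (rule holomorphic_onI)
      fix y assume "y \<in> S"
      then obtain z where "z \<in> unit_disc" "y = ?G z" by (auto simp: S_def)
      then show "H field_differentiable at y within S"
        using has_field_derivative_at_within[OF der] field_differentiable_def by blast
    qed
    show "Re (deriv H y) > 0" if "y \<in> S" for y
      using that N DERIV_imp_deriv[OF der] by (auto simp: S_def)
  qed
  show ?thesis
  proof (rule inj_onI)
    fix x y assume xy: "x \<in> unit_disc" "y \<in> unit_disc" "Q x = Q y"
    then have "H (?G x) = H (?G y)" by (simp add: H_def Gi del: mem_ball)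
    then have "?G x = ?G y" using \<open>inj_on H S\<close> xy by (auto simp: S_def inj_on_def)
    then show "x = y" using injG xy by (auto dest: inj_onD)
  qed
qed

section \<open>Comparison with the dominant by first contact\<close>

lemma higher_order_Schwarz:
  assumes w: "w holomorphic_on unit_disc" and k: "k holomorphic_on unit_disc"
    and bound: "\<And>z. z \<in> unit_disc \<Longrightarrow> norm (w z) < 1"
    and wk: "\<And>z. z \<in> unit_disc \<Longrightarrow> w z = z ^ n * k z"
    and z: "z \<in> unit_disc"
  shows "norm (w z) \<le> norm z ^ n"
proof -
  have *: "r ^ n * norm (k z) \<le> 1" if r: "norm z < r" "r < 1" for r
  proof -
    have r0: "r > 0" using r norm_ge_zero[of z] by linarith
    have sub: "cball 0 r \<subseteq> unit_disc" using r by auto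
    \<comment> \<open>On the circle of radius \<open>r\<close> the bound on \<open>w\<close> reads
      \<open>r^n norm (k x) \<le> 1\<close>; the maximum principle carries it inside, and
      \<open>r\<close> then tends to 1.\<close>
    have "norm (k z) \<le> 1 / r ^ n"
    proof (rule maximum_modulus_frontier[of k "cball 0 r"])
      show "k holomorphic_on interior (cball 0 r)"
        by (rule holomorphic_on_subset[OF k]) (use r in auto)
      show "continuous_on (closure (cball 0 r)) k"
        by (rule holomorphic_on_imp_continuous_on[OF holomorphic_on_subset[OF k]]) (use sub in simp)
      show "norm (k x) \<le> 1 / r ^ n" if "x \<in> frontier (cball 0 r)" for x
      proof -
        have x: "norm x = r" "x \<in> unit_disc" using that r by auto
        then have "r ^ n * norm (k x) \<le> 1"
          using bound[of x] wk[of x] by (simp add: norm_mult norm_power)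
        then show ?thesis using r0 by (simp add: field_simps)
      qed
    qed (use r in auto)
    then show ?thesis using r0 by (simp add: field_simps)
  qed
  have "norm (k z) \<le> 1"
  proof (rule tendsto_upperbound)
    show "((\<lambda>r. r ^ n * norm (k z)) \<longlongrightarrow> norm (k z)) (at_left 1)"
      by (auto intro!: tendsto_eq_intros)
    show "\<forall>\<^sub>F r in at_left 1. r ^ n * norm (k z) \<le> 1"
      using * z by (auto simp: eventually_at_left intro!: exI[of _ "norm z"])
  qed simp
  then show ?thesis
    unfolding wk[OF z] norm_mult norm_power by (simp add: mult_left_le)
qed

text \<open>Miller--Mocanu argument: write \<open>v = Q\<^sup>-\<^sup>1 \<circ> g = z ^ n \<omega>\<close>. Where \<open>norm \<omega> > 1\<close> is maximal over
  a disc, \<open>z v' = s n v\<close> with \<open>s \<ge> 1\<close>, hence \<open>G w = G v + (s - 1) v G'(v) N(v)\<close> with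
  \<open>norm w < norm v\<close>, against the outer normal condition.\<close>
lemma norm_inverse_dominant_le:
  assumes B: "\<bar>B\<bar> \<le> 1" "A \<noteq> B" and c: "c \<noteq> 0" and n: "n \<ge> 1"
    and Q: "Q holomorphic_on unit_disc"
    and ode: "\<And>z. z \<in> unit_disc \<Longrightarrow> Q z + z * deriv Q z / c = moebius_AB A B z"
    and dQ: "\<And>z. z \<in> unit_disc \<Longrightarrow>
      deriv Q z = c * N z * (of_real (A - B) / (1 + of_real B * z)\<^sup>2)"
    and N: "\<And>z. z \<in> unit_disc \<Longrightarrow> Re (N z) > 0"
    and Qi: "Qi holomorphic_on Q ` unit_disc" "\<And>z. z \<in> unit_disc \<Longrightarrow> Qi (Q z) = z"
    and g: "g holomorphic_on ball 0 r" and r: "r \<le> 1"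
    and k: "k holomorphic_on ball 0 r" and gk: "\<And>z. z \<in> ball 0 r \<Longrightarrow> g z - 1 = z ^ n * k z"
    and sub: "g ` ball 0 r \<subseteq> Q ` unit_disc"
    and gw: "\<And>z. z \<in> ball 0 r \<Longrightarrow>
      g z + z * deriv g z / (c * of_nat n) = moebius_AB A B (w z)"
    and w: "\<And>z. z \<in> ball 0 r \<Longrightarrow> norm (w z) \<le> norm z ^ n"
    and z1: "z1 \<in> ball 0 r"
  shows "norm (Qi (g z1)) \<le> norm z1 ^ n"
proof (rule ccontr)
  define S where "S = Q ` unit_disc"
  have Q0: "Q 0 = 1" using ode[of 0] by (simp add: moebius_AB_def)
  have "inj_on Q unit_disc" by (rule inj_on_moebius_dominant[OF B c Q dQ N])
  then have "open S" unfolding S_def using Q by (intro open_mapping_thm3) auto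
  have Qi1: "Qi 1 = 0" using Qi(2)[of 0] Q0 by simp
  \<comment> \<open>The difference quotient of \<open>Qi\<close> at 1, completed at its removable
    singularity, yields \<open>Qi (g z) = (g z - 1) q (g z)\<close>. The cofactor of
    \<open>z^n\<close> is thus holomorphic at 0 as well.\<close>
  define q where "q y = (if y = 1 then deriv Qi 1 else (Qi y - Qi 1) / (y - 1))" for y
  have q: "q holomorphic_on S"
    unfolding q_def using Qi(1) \<open>open S\<close> unfolding S_def by (intro pole_lemma_open)
  define v where "v z = Qi (g z)" for z
  define om where "om z = k z * q (g z)" for z
  have v_om: "v z = z ^ n * om z" if "z \<in> ball 0 r" for z
  proof -
    have "Qi (g z) = (g z - 1) * q (g z)" by (simp add: q_def Qi1)
    then show ?thesis using gk[OF that] by (simp add: v_def om_def)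
  qed
  have om: "om holomorphic_on ball 0 r"
    unfolding om_def
    using holomorphic_on_mult[OF k holomorphic_on_compose_gen[OF g q sub[folded S_def]]]
    by (simp only: o_def)
  have v: "v holomorphic_on ball 0 r"
    unfolding v_def using holomorphic_on_compose_gen[OF g Qi(1) sub] by (simp only: o_def)
  have v_unit: "v z \<in> unit_disc" "Q (v z) = g z" if "z \<in> ball 0 r" for z
  proof -
    have "g z \<in> Q ` unit_disc" using sub that by (rule subsetD[OF _ imageI])
    then obtain x where "g z = Q x" "x \<in> unit_disc" by (rule imageE)
    then show "v z \<in> unit_disc" "Q (v z) = g z" by (simp_all only: v_def Qi(2))
  qed
  assume "\<not> ?thesis"
  then have v1: "norm (v z1) > norm z1 ^ n" by (simp add: v_def)
  define R where "R = norm z1"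
  have z1_0: "z1 \<noteq> 0" using v1 v_om[OF z1] n by (auto simp: power_0_left)
  then have "R > 0" by (simp add: R_def)
  have subR: "cball 0 R \<subseteq> ball 0 r" using z1 by (auto simp: R_def)
  have "norm (om z1) > 1"
    using v1 v_om[OF z1] z1_0 by (simp add: norm_mult norm_power)
  have om_cont: "continuous_on (cball 0 R) om"
    by (rule holomorphic_on_imp_continuous_on[OF holomorphic_on_subset[OF om subR]])
  then have "continuous_on (sphere 0 R) (\<lambda>z. norm (om z))"
    by (intro continuous_on_norm) (rule continuous_on_subset, auto)
  then obtain z0 where z0: "z0 \<in> sphere 0 R"
    and max': "\<And>z. z \<in> sphere 0 R \<Longrightarrow> norm (om z) \<le> norm (om z0)"
    using continuous_attains_sup[of "sphere 0 R" "\<lambda>z. norm (om z)"] \<open>R > 0\<close> by auto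
  have nz0: "norm z0 = R" using z0 by simp
  then have z0_0: "z0 \<noteq> 0" and z0r: "z0 \<in> ball 0 r" using \<open>R > 0\<close> z1 by (auto simp: R_def)
  have max: "norm (om z) \<le> norm (om z0)" if "norm z \<le> norm z0" for z
  proof (rule maximum_modulus_frontier[of om "cball 0 R"])
    show "om holomorphic_on interior (cball 0 R)"
      by (rule holomorphic_on_subset[OF om]) (use subR in auto)
  qed (use om_cont that nz0 max' in auto)
  have om_gt1: "norm (om z0) > 1"
    using max[of z1] \<open>norm (om z1) > 1\<close> nz0 by (simp add: R_def)
  then have om0: "om z0 \<noteq> 0" by auto
  \<comment> \<open>Dividing by \<open>om z0\<close> turns the maximum of the modulus into a maximum
    of the real part, attained with \<open>h z0 = 1\<close>; hence
    \<open>z0 om'(z0) = m om(z0)\<close> with real \<open>m \<ge> 0\<close>.\<close>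
  define h where "h z = om z / om z0" for z
  have h: "h holomorphic_on ball 0 r" unfolding h_def by (intro holomorphic_intros om om0)
  have Re_h: "Re (h z) \<le> Re (h z0)" if "norm z \<le> norm z0" for z
  proof -
    have "norm (h z) \<le> 1" using max[OF that] om0 by (simp add: h_def norm_divide)
    then show ?thesis using complex_Re_le_cmod[of "h z"] om0 by (simp add: h_def)
  qed
  have subz0: "cball 0 (norm z0) \<subseteq> ball 0 r" using subR nz0 by simp
  define m where "m = Re (z0 * deriv h z0)"
  have hm: "z0 * deriv h z0 = of_real m" and m0: "m \<ge> 0"
    using mult_deriv_at_Re_max[OF h open_ball subz0 Re_h] by (simp_all add: m_def complex_eq_iff)
  have om_der: "(om has_field_derivative deriv om z0) (at z0)"
    by (rule holomorphic_derivI[OF om open_ball z0r])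
  then have "deriv h z0 = deriv om z0 / om z0"
    unfolding h_def by (intro DERIV_imp_deriv DERIV_cdivide)
  then have "z0 * deriv om z0 = om z0 * (z0 * deriv h z0)" using om0 by simp
  then have om_m: "z0 * deriv om z0 = of_real m * om z0" by (simp only: hm mult.commute)
  have "((\<lambda>z. z ^ n * om z) has_field_derivative
      of_nat n * z0 ^ (n - 1) * om z0 + z0 ^ n * deriv om z0) (at z0)"
    using om_der by (auto intro!: derivative_eq_intros)
  then have "(v has_field_derivative
      of_nat n * z0 ^ (n - 1) * om z0 + z0 ^ n * deriv om z0) (at z0)"
    by (rule has_field_derivative_transform_within_open[OF _ open_ball z0r]) (simp add: v_om)
  then have "deriv v z0 = of_nat n * z0 ^ (n - 1) * om z0 + z0 ^ n * deriv om z0"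
    by (rule DERIV_imp_deriv)
  then have "z0 * deriv v z0 = of_nat n * (z0 * z0 ^ (n - 1)) * om z0 + z0 ^ n * (z0 * deriv om z0)"
    by (simp add: algebra_simps)
  also have "z0 * z0 ^ (n - 1) = z0 ^ n" using n by (simp flip: power_Suc)
  finally have zv: "z0 * deriv v z0 = (of_nat n + of_real m) * v z0"
    unfolding om_m v_om[OF z0r] by (simp add: algebra_simps)
  have "((\<lambda>z. Q (v z)) has_field_derivative deriv Q (v z0) * deriv v z0) (at z0)"
    by (rule DERIV_chain2) (use holomorphic_derivI[OF Q open_ball v_unit(1)[OF z0r]]
        holomorphic_derivI[OF v open_ball z0r] in auto)
  then have "(g has_field_derivative deriv Q (v z0) * deriv v z0) (at z0)"
    by (rule has_field_derivative_transform_within_open[OF _ open_ball z0r]) (simp add: v_unit)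
  then have dg: "z0 * deriv g z0 = deriv Q (v z0) * (z0 * deriv v z0)"
    by (simp add: DERIV_imp_deriv)
  define D where "D = of_real (A - B) / (1 + of_real B * v z0)\<^sup>2"
  have n0: "of_nat n \<noteq> (0::complex)" using n by simp
  have vu: "v z0 \<in> unit_disc" by (rule v_unit[OF z0r])
  have "moebius_AB A B (w z0) = g z0 + z0 * deriv g z0 / (c * of_nat n)"
    using gw[OF z0r] by simp
  \<comment> \<open>As \<open>z0 v'(z0) = (n + m) v(z0)\<close>, division by \<open>c n\<close>
    splits off \<open>v Q'(v) / c\<close>, which completes the Euler equation of \<open>Q\<close> at
    \<open>v z0\<close>. The excess carries the factor \<open>m / n\<close>, so
    \<open>s = 1 + m / n\<close>.\<close>
  also have "\<dots> = Q (v z0) + v z0 * deriv Q (v z0) / c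
      + (of_real m / of_nat n) * (v z0 * deriv Q (v z0) / c)"
    unfolding dg zv v_unit(2)[OF z0r, symmetric] using n0 c by (simp add: field_simps)
  also have "\<dots> = moebius_AB A B (v z0) + (of_real (m / n) * N (v z0)) * (v z0 * D)"
    unfolding ode[OF vu] unfolding dQ[OF vu] D_def[symmetric] using c by simp
  finally have "moebius_AB A B (w z0)
    = moebius_AB A B (v z0) + (of_real (m / n) * N (v z0)) * (v z0 * D)" .
  moreover have "norm (w z0) < norm (v z0)"
  proof -
    have "norm z0 ^ n * 1 < norm z0 ^ n * norm (om z0)"
      using om_gt1 z0_0 by (intro mult_strict_left_mono) auto
    then show ?thesis using w[OF z0r] v_om[OF z0r] by (simp add: norm_mult norm_power)
  qed
  moreover have "Re (of_real (m / n) * N (v z0)) \<ge> 0"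
    unfolding Re_complex_of_real times_complex.sel using N[OF vu] m0 by simp
  moreover have "norm (v z0) < 1" using vu by simp
  ultimately show False
    using moebius_AB_outer_normal[OF B, of "w z0" "v z0"] unfolding D_def by blast
qed

text \<open>Let \<open>z0\<close> be a point of least modulus \<open>s\<close> at which
  \<open>g\<close> leaves the image of \<open>Q\<close>. On the open disc of radius \<open>s\<close>
  the inverse estimate applies and traps \<open>g\<close> in the image under \<open>Q\<close> of the
  closed disc of radius \<open>s^n\<close>. That image is compact, so it contains
  \<open>g z0\<close> too, a contradiction.\<close>

lemma image_subset_dominant:
  assumes B: "\<bar>B\<bar> \<le> 1" "A \<noteq> B" and c: "c \<noteq> 0" and n: "n \<ge> 1"
    and Q: "Q holomorphic_on unit_disc"
    and ode: "\<And>z. z \<in> unit_disc \<Longrightarrow> Q z + z * deriv Q z / c = moebius_AB A B z"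
    and dQ: "\<And>z. z \<in> unit_disc \<Longrightarrow>
      deriv Q z = c * N z * (of_real (A - B) / (1 + of_real B * z)\<^sup>2)"
    and N: "\<And>z. z \<in> unit_disc \<Longrightarrow> Re (N z) > 0"
    and g: "g holomorphic_on unit_disc" and k: "k holomorphic_on unit_disc"
    and gk: "\<And>z. z \<in> unit_disc \<Longrightarrow> g z - 1 = z ^ n * k z"
    and gw: "\<And>z. z \<in> unit_disc \<Longrightarrow>
      g z + z * deriv g z / (c * of_nat n) = moebius_AB A B (w z)"
    and w: "\<And>z. z \<in> unit_disc \<Longrightarrow> norm (w z) \<le> norm z ^ n"
  shows "g ` unit_disc \<subseteq> Q ` unit_disc"
proof (rule ccontr)
  assume "\<not> ?thesis"
  then obtain z2 where z2: "z2 \<in> unit_disc" "g z2 \<notin> Q ` unit_disc" by blast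
  have inj: "inj_on Q unit_disc" by (rule inj_on_moebius_dominant[OF B c Q dQ N])
  then have "open (Q ` unit_disc)" using Q by (intro open_mapping_thm3) auto
  obtain Qi where Qi: "Qi holomorphic_on Q ` unit_disc"
    "\<And>z. z \<in> unit_disc \<Longrightarrow> Qi (Q z) = z"
    by (rule holomorphic_has_inverse[OF Q open_ball inj]) (rule that)
  define K where "K = {z \<in> cball 0 (norm z2). g z \<in> - Q ` unit_disc}"
  have contg: "continuous_on (cball 0 s) g" if "s < 1" for s
    by (rule holomorphic_on_imp_continuous_on[OF holomorphic_on_subset[OF g]]) (use that in auto)
  have "closed K"
    unfolding K_def using z2 \<open>open (Q ` unit_disc)\<close>
      continuous_closed_preimage[OF contg closed_cball closed_Compl, of "norm z2" "Q ` unit_disc"]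
    by (simp add: vimage_def Int_def)
  moreover have "bounded K"
    by (rule bounded_subset[OF bounded_cball[of 0 "norm z2"]]) (auto simp: K_def)
  ultimately have "compact K" by (simp add: compact_eq_bounded_closed)
  moreover have "z2 \<in> K" using z2 by (auto simp: K_def)
  ultimately obtain z0 where z0: "z0 \<in> K" and min: "\<And>z. z \<in> K \<Longrightarrow> norm z0 \<le> norm z"
    using continuous_attains_inf[of K norm] continuous_on_norm_id by blast
  define s where "s = norm z0"
  have s1: "s < 1" using z0 z2 by (auto simp: K_def s_def)
  have "g 0 = Q 0" using gk[of 0] ode[of 0] n by (simp add: moebius_AB_def power_0_left)
  then have "s > 0" using z0 by (auto simp: K_def s_def)
  have gs: "g ` ball 0 s \<subseteq> Q ` unit_disc"
  proof (rule ccontr)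
    assume "\<not> ?thesis"
    then obtain x where "x \<in> ball 0 s" and gx: "g x \<notin> Q ` unit_disc" by blast
    then have x: "norm x < s" by simp
    have "s \<le> norm z2" using z0 by (auto simp: K_def s_def)
    then have "x \<in> K" using x gx by (simp add: K_def)
    then show False using min[of x] x by (simp add: s_def)
  qed
  have ss: "ball 0 s \<subseteq> unit_disc" using s1 by auto
  have sn: "s ^ n < 1" using power_strict_decreasing[of 0 n s] s1 \<open>s > 0\<close> n by simp
  have "g ` closure (ball 0 s) \<subseteq> Q ` cball 0 (s ^ n)"
  proof (rule image_closure_subset)
    show "continuous_on (closure (ball 0 s)) g" using contg[OF s1] \<open>s > 0\<close> by simp
    have "continuous_on (cball 0 (s ^ n)) Q"
      by (rule holomorphic_on_imp_continuous_on[OF holomorphic_on_subset[OF Q]]) (use sn in auto)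
    then show "closed (Q ` cball 0 (s ^ n))"
      by (intro compact_imp_closed compact_continuous_image compact_cball)
    show "g ` ball 0 s \<subseteq> Q ` cball 0 (s ^ n)"
    proof
      fix y assume "y \<in> g ` ball 0 s"
      then obtain x where x: "x \<in> ball 0 s" "y = g x" by blast
      have "norm (Qi (g x)) \<le> norm x ^ n"
      proof (rule norm_inverse_dominant_le[OF B c n Q ode dQ N Qi])
        show "g holomorphic_on ball 0 s" "k holomorphic_on ball 0 s"
          by (rule holomorphic_on_subset[OF _ ss], fact)+
        show "s \<le> 1" "g ` ball 0 s \<subseteq> Q ` unit_disc" "x \<in> ball 0 s"
          using s1 gs x by auto
        fix z :: complex assume "z \<in> ball 0 s"
        then have "z \<in> unit_disc" using ss by blast
        then show "g z - 1 = z ^ n * k z" "norm (w z) \<le> norm z ^ n"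
          "g z + z * deriv g z / (c * of_nat n) = moebius_AB A B (w z)"
          by (fact gk w gw)+
      qed
      also have "\<dots> \<le> s ^ n" using x by (intro power_mono) auto
      finally have "Qi (g x) \<in> cball 0 (s ^ n)" by simp
      moreover have "Q (Qi (g x)) = g x" using gs x Qi(2) by (metis image_eqI image_iff subsetD)
      ultimately show "y \<in> Q ` cball 0 (s ^ n)" using x by (metis image_eqI)
    qed
  qed
  moreover have "z0 \<in> closure (ball 0 s)" using \<open>s > 0\<close> by (simp add: s_def)
  moreover have "cball 0 (s ^ n) \<subseteq> unit_disc" using sn by auto
  ultimately have "g z0 \<in> Q ` unit_disc" by blast
  then show False using z0 by (simp add: K_def)
qed

section \<open>Integral formula for the dominant and convergence of the integral\<close>

lemma bound_fun_eq:
  assumes c: "Re c > 0" and Q: "Q holomorphic_on unit_disc"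
    and ode: "\<And>z. z \<in> unit_disc \<Longrightarrow> Q z + z * deriv Q z / c = moebius_AB A B z"
    and zeta: "\<zeta> \<in> unit_disc"
  shows "bound_fun c A B \<zeta> = Q \<zeta>"
proof -
  have c0: "c \<noteq> 0" using c by auto
  have in_disc: "\<zeta> * of_real x \<in> unit_disc" if "0 \<le> x" "x \<le> 1" for x
    using that zeta mult_left_le[of x "norm \<zeta>"] by (simp add: norm_mult)
  \<comment> \<open>The derivative of \<open>u^c Q (\<zeta> u)\<close> is \<open>c u^(c-1)\<close>
    times the left side of the Euler equation at \<open>\<zeta> u\<close>, hence \<open>c\<close>
    times the integrand. With \<open>Re c > 0\<close> this primitive is continuous at 0 with value
    0, but possibly not differentiable there.\<close>
  define \<Phi> where "\<Phi> y = y powr c * Q (\<zeta> * y)" for y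
  have "((\<lambda>u. c * bound_integrand c A B \<zeta> u) has_integral
      \<Phi> (of_real 1) - \<Phi> (of_real 0)) {0..1}"
  proof (rule fundamental_theorem_of_calculus_interior)
    show "continuous_on {0..1} (\<lambda>u. \<Phi> (of_real u))"
      unfolding \<Phi>_def
    proof (rule continuous_on_mult)
      show "continuous_on {0..1} (\<lambda>u. complex_of_real u powr c)"
        using c by (intro continuous_on_powr_complex continuous_intros) auto
      show "continuous_on {0..1} (\<lambda>u. Q (\<zeta> * complex_of_real u))"
        by (rule continuous_on_compose2[OF holomorphic_on_imp_continuous_on[OF Q]])
          (use in_disc in \<open>auto intro!: continuous_intros\<close>)
    qed
    fix x :: real assume "x \<in> {0<..<1}"
    then have x: "0 < x" "x < 1" by auto
    have zx: "\<zeta> * of_real x \<in> unit_disc" using in_disc x by simp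
    have "((\<lambda>y. Q (\<zeta> * y)) has_field_derivative deriv Q (\<zeta> * of_real x) * \<zeta>) (at (of_real x))"
      by (rule DERIV_chain2[where f = Q and g = "\<lambda>y. \<zeta> * y",
            OF holomorphic_derivI[OF Q open_ball zx]])
        (auto intro!: derivative_eq_intros)
    moreover have "((\<lambda>y. y powr c) has_field_derivative c * of_real x powr (c - 1)) (at (of_real x))"
      using x by (intro has_field_derivative_powr) auto
    ultimately have "(\<Phi> has_field_derivative
        (c * of_real x powr (c - 1)) * Q (\<zeta> * of_real x)
        + deriv Q (\<zeta> * of_real x) * \<zeta> * of_real x powr c) (at (of_real x))"
      unfolding \<Phi>_def by (intro DERIV_mult)
    also have "of_real x powr c = of_real x * of_real x powr (c - 1)"
      using powr_add[of "of_real x :: complex" 1 "c - 1"] x by simp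
    also have "(c * of_real x powr (c - 1)) * Q (\<zeta> * of_real x)
        + deriv Q (\<zeta> * of_real x) * \<zeta> * (of_real x * of_real x powr (c - 1))
        = c * bound_integrand c A B \<zeta> x"
      unfolding bound_integrand_def ode[OF zx, symmetric] using c0 by (simp add: algebra_simps)
    finally show "((\<lambda>u. \<Phi> (of_real u)) has_vector_derivative c * bound_integrand c A B \<zeta> x) (at x)"
      by (rule has_vector_derivative_real_field)
  qed simp
  then have "integral {0..1} (\<lambda>u. c * bound_integrand c A B \<zeta> u) = Q \<zeta>"
    by (intro integral_unique) (simp add: \<Phi>_def)
  then show ?thesis by (simp add: bound_fun_def)
qed

text \<open>Integrability gives a limit \<open>L\<close> of \<open>exp (- c t)\<close> as \<open>t \<rightarrow> \<infinity>\<close>. If \<open>Re c \<le> 0\<close> then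
  \<open>norm L \<ge> 1\<close>, and shifting \<open>t\<close> by \<open>s\<close> shows \<open>exp (- c s) = 1\<close> for all \<open>s\<close>.\<close>
lemma Re_pos_if_powr_integrable:
  assumes c: "c \<noteq> 0" and int: "(\<lambda>u. of_real u powr (c - 1)) integrable_on {0..1}"
  shows "Re c > 0"
proof (rule ccontr)
  assume neg: "\<not> ?thesis"
  define J where "J x = integral {x..1} (\<lambda>u. complex_of_real u powr (c - 1))" for x
  have J: "c * J x = 1 - of_real x powr c" if x: "0 < x" "x \<le> 1" for x
  proof -
    have "((\<lambda>u. c * of_real u powr (c - 1)) has_integral
        (of_real 1 powr c - of_real x powr c)) {x..1}"
    proof (rule fundamental_theorem_of_calculus)
      fix u assume "u \<in> {x..1}"
      then have "((\<lambda>y. y powr c) has_field_derivative c * of_real u powr (c - 1)) (at (of_real u))"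
        using x by (intro has_field_derivative_powr) auto
      then show "((\<lambda>u. of_real u powr c) has_vector_derivative c * of_real u powr (c - 1))
          (at u within {x..1})"
        by (rule has_vector_derivative_real_field)
    qed (use x in auto)
    then have "integral {x..1} (\<lambda>u. c * of_real u powr (c - 1)) = 1 - of_real x powr c"
      by (intro integral_unique) simp
    then show ?thesis by (simp add: J_def)
  qed
  have "continuous_on {0..1} J"
    unfolding J_def using int by (rule indefinite_integral_continuous_1')
  then have "(J \<longlongrightarrow> J 0) (at 0 within {0..1})" by (simp add: continuous_on)
  \<comment> \<open>The substitution \<open>x = exp (- t)\<close> turns the limit at 0 into one at
    infinity and the power \<open>x^c\<close> into \<open>exp (- c t)\<close>.\<close>
  moreover have "filterlim (\<lambda>t. exp (- t)) (at 0 within {0..1}) (at_top :: real filter)"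
    unfolding filterlim_at
  proof
    show "((\<lambda>t. exp (- t)) \<longlongrightarrow> 0) (at_top :: real filter)"
      by (rule filterlim_compose[OF exp_at_bot filterlim_uminus_at_bot_at_top])
    show "\<forall>\<^sub>F t in at_top. exp (- t) \<in> {0..1} \<and> exp (- t) \<noteq> (0 :: real)"
      using eventually_ge_at_top[of "0 :: real"] by eventually_elim auto
  qed
  ultimately have "((\<lambda>t. J (exp (- t))) \<longlongrightarrow> J 0) at_top"
    by (rule filterlim_compose)
  then have "((\<lambda>t. 1 - c * J (exp (- t))) \<longlongrightarrow> 1 - c * J 0) at_top"
    by (intro tendsto_intros)
  moreover have "\<forall>\<^sub>F t in at_top. 1 - c * J (exp (- t)) = exp (- c * of_real t)"
    using eventually_ge_at_top[of 0]
  proof eventually_elim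
    case (elim t)
    have "of_real (exp (- t)) powr c = exp (- c * of_real t)"
      by (simp add: powr_def Ln_of_real)
    then show ?case using J[of "exp (- t)"] elim by simp
  qed
  ultimately have lim: "((\<lambda>t. exp (- c * of_real t)) \<longlongrightarrow> 1 - c * J 0) at_top"
    by (rule Lim_transform_eventually)
  define L where "L = 1 - c * J 0"
  have "1 \<le> norm L"
  proof (rule tendsto_lowerbound)
    show "((\<lambda>t. norm (exp (- c * of_real t))) \<longlongrightarrow> norm L) at_top"
      unfolding L_def using lim by (rule tendsto_norm)
    show "\<forall>\<^sub>F t in at_top. 1 \<le> norm (exp (- c * of_real t))"
      using eventually_ge_at_top[of 0]
      by eventually_elim (use neg in \<open>auto simp: mult_nonpos_nonneg\<close>)
  qed simp
  then have L0: "L \<noteq> 0" by auto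
  have one: "exp (- c * of_real s) = 1" for s
  proof -
    have "filterlim (\<lambda>t. s + t) at_top at_top"
      by (intro filterlim_tendsto_add_at_top[OF tendsto_const] filterlim_ident)
    with lim have "((\<lambda>t. exp (- c * of_real (s + t))) \<longlongrightarrow> L) at_top"
      unfolding L_def by (rule filterlim_compose)
    moreover have "((\<lambda>t. exp (- c * of_real s) * exp (- c * of_real t))
        \<longlongrightarrow> exp (- c * of_real s) * L) at_top"
      unfolding L_def using lim by (intro tendsto_intros)
    moreover have "exp (- c * of_real (s + t)) = exp (- c * of_real s) * exp (- c * of_real t)" for t
      by (simp add: algebra_simps flip: exp_add)
    ultimately have "exp (- c * of_real s) * L = L"
      by (simp only: tendsto_unique[OF trivial_limit_at_top_linorder])
    then show ?thesis using L0 by simp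
  qed
  \<comment> \<open>At \<open>s = 1 / norm c\<close> the exponent has modulus 1, whereas
    \<open>exp x = 1\<close> puts it among the integer multiples of
    \<open>2 pi \<i>\<close>.\<close>
  define x where "x = - c * of_real (1 / norm c)"
  have "norm x = 1" using c by (simp add: x_def norm_mult norm_divide)
  obtain k :: int where k: "Re x = 0" "Im x = of_int (2 * k) * pi"
    using one[of "1 / norm c"] unfolding x_def[symmetric] exp_eq_1 by blast
  then have "x = \<i> * of_real (Im x)" by (simp add: complex_eq_iff)
  then have "\<bar>Im x\<bar> = 1" using \<open>norm x = 1\<close>
    by (metis norm_mult norm_ii norm_of_real mult_1)
  then have *: "\<bar>of_int (2 * k)\<bar> * pi = 1" using k by (simp add: abs_mult)
  then have "k \<noteq> 0" by auto
  then have "(1::real) \<le> \<bar>of_int (2 * k)\<bar>" by linarith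
  then have "1 * pi \<le> \<bar>of_int (2 * k)\<bar> * pi" by (intro mult_right_mono) auto
  then show False using * pi_gt3 by linarith
qed

subsection \<open>Analytic branch of the power\<close>

text \<open>The origin alone accounts for \<open>p\<close> zeros of \<open>f\<close>, so p-valence
  at the value 0 leaves no room for another one. This is what makes \<open>z^p/f\<close> free of
  poles.\<close>

lemma class_A_factor:
  assumes n: "n \<ge> 1" and p: "p \<ge> 1" and f: "f \<in> class_A p n"
  obtains \<phi> where "\<phi> holomorphic_on unit_disc"
    and "\<And>z. z \<in> unit_disc \<Longrightarrow> f z = z ^ p * (1 + z ^ n * \<phi> z)"
    and "\<And>z. z \<in> unit_disc \<Longrightarrow> 1 + z ^ n * \<phi> z \<noteq> 0"
proof -
  have fh: "f holomorphic_on unit_disc" and val: "p_valent p f unit_disc"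
    using f by (auto simp: class_A_def)
  obtain a where a: "\<And>z. z \<in> unit_disc \<Longrightarrow>
      (\<lambda>k. a (n + k + p) * z ^ (n + k + p)) sums (f z - z ^ p)"
    using f unfolding class_A_def by blast
  define \<phi> where "\<phi> z = (if z = 0 then a (n + p) else (f z - z ^ p) / z ^ (n + p))" for z
  have "(\<lambda>k. a (n + k + p) * (z - 0) ^ k) sums \<phi> z" if z: "z \<in> unit_disc" for z
  proof (cases "z = 0")
    case True
    then show ?thesis using powser_sums_zero[of "\<lambda>k. a (n + k + p)"] by (simp add: \<phi>_def)
  next
    case False
    have "(\<lambda>k. a (n + k + p) * z ^ (n + k + p) / z ^ (n + p)) sums ((f z - z ^ p) / z ^ (n + p))"
      by (intro sums_divide a z)
    moreover have "a (n + k + p) * z ^ (n + k + p) / z ^ (n + p) = a (n + k + p) * z ^ k" for k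
      using False by (simp add: power_add)
    ultimately show ?thesis using False by (simp add: \<phi>_def)
  qed
  then have \<phi>: "\<phi> holomorphic_on unit_disc" by (rule power_series_holomorphic)
  have f0: "f 0 = 0"
  proof -
    have "(\<lambda>k. 0) sums (f 0)" using a[of 0] n p by (simp add: power_0_left)
    then show ?thesis using sums_unique2 sums_zero by blast
  qed
  have eq: "f z = z ^ p * (1 + z ^ n * \<phi> z)" for z
    using f0 p by (cases "z = 0") (auto simp: \<phi>_def power_add field_simps power_0_left)
  define \<kappa> where "\<kappa> z = 1 + z ^ n * \<phi> z" for z
  have \<kappa>: "\<kappa> holomorphic_on unit_disc" unfolding \<kappa>_def by (intro holomorphic_intros \<phi>)
  define Z where "Z = {z \<in> unit_disc. f z = 0}"
  have finZ: "finite Z" and sumZ: "(\<Sum>z\<in>Z. zorder f z) \<le> int p"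
    using conjunct1[OF val[unfolded p_valent_def], THEN spec, of 0] unfolding Z_def by simp_all
  have ord0: "zorder f 0 = int p"
  proof (rule zorder_eqI[OF open_ball _ \<kappa>])
    show "f w = \<kappa> w * (w - 0) powi int p" for w
      using eq[of w] by (simp add: \<kappa>_def power_int_of_nat)
  qed (use n in \<open>auto simp: \<kappa>_def power_0_left\<close>)
  \<comment> \<open>Finiteness of \<open>Z\<close> isolates each zero, so \<open>zorder\<close> is
    its genuine, positive multiplicity.\<close>
  have ord_pos: "zorder f x > 0" if x: "x \<in> Z" for x
  proof -
    have xu: "x \<in> unit_disc" using x by (simp add: Z_def)
    have "\<forall>\<^sub>F z in at x. z \<notin> Z"
      using islimpt_finite[OF finZ] by (simp add: islimpt_iff_eventually)
    moreover have "\<forall>\<^sub>F z in at x. z \<in> unit_disc"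
      using xu by (intro eventually_at_in_open') auto
    ultimately have "\<forall>\<^sub>F z in at x. f z \<noteq> 0"
      by eventually_elim (auto simp: Z_def)
    then have "\<exists>\<^sub>F z in at x. f z \<noteq> 0" by (intro eventually_frequently) auto
    then show ?thesis using zorder_pos_iff[OF fh open_ball xu] x by (simp add: Z_def)
  qed
  have "\<kappa> z \<noteq> 0" if z: "z \<in> unit_disc" for z
  proof
    assume kz: "\<kappa> z = 0"
    then have z0: "z \<noteq> 0" using n by (auto simp: \<kappa>_def power_0_left)
    have sub: "{0, z} \<subseteq> Z" using z kz eq[of z] f0 by (auto simp: Z_def \<kappa>_def)
    then have "(\<Sum>x\<in>{0, z}. zorder f x) \<le> (\<Sum>x\<in>Z. zorder f x)"
      using finZ ord_pos by (intro sum_mono2) (auto intro: less_imp_le)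
    then have "zorder f 0 + zorder f z \<le> int p" using z0 sumZ by simp
    then show False using ord0 ord_pos[of z] sub by simp
  qed
  then show ?thesis using that[OF \<phi> eq] by (simp add: \<kappa>_def)
qed

text \<open>Multiplication by \<open>- \<i>\<close> rotates the closed upper half-plane to the
  closed right one, which meets the branch cut only at 0. There \<open>Ln\<close> is continuous, and
  the rotation costs the constant \<open>\<i> pi / 2\<close>.\<close>

lemma tendsto_Ln_upper_halfplane:
  assumes f: "(f \<longlongrightarrow> l) F" and l: "l \<noteq> 0" "Im l \<ge> 0" and upper: "\<forall>\<^sub>F x in F. Im (f x) \<ge> 0"
  shows "((\<lambda>x. Ln (f x)) \<longlongrightarrow> Ln l) F"
proof -
  have eq: "Ln (- \<i> * y) + \<i> * of_real pi / 2 = Ln y" if "y \<noteq> 0" "Im y \<ge> 0" for y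
    using Ln_times_ii[of "- \<i> * y"] that by (simp flip: mult.assoc)
  have "- \<i> * l \<notin> \<real>\<^sub>\<le>\<^sub>0"
    using l by (auto simp: complex_nonpos_Reals_iff complex_eq_iff)
  moreover have "((\<lambda>x. - \<i> * f x) \<longlongrightarrow> - \<i> * l) F" using f by (intro tendsto_intros)
  ultimately have "((\<lambda>x. Ln (- \<i> * f x) + \<i> * of_real pi / 2) \<longlongrightarrow> Ln (- \<i> * l) + \<i> * of_real pi / 2) F"
    by (intro tendsto_add tendsto_Ln tendsto_const)
  moreover have "\<forall>\<^sub>F x in F. f x \<noteq> 0" using f l(1) by (rule tendsto_imp_eventually_ne)
  then have "\<forall>\<^sub>F x in F. Ln (- \<i> * f x) + \<i> * of_real pi / 2 = Ln (f x)"
    using upper by eventually_elim (rule eq)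
  ultimately show ?thesis unfolding eq[OF l] by (rule Lim_transform_eventually)
qed

text \<open>Near \<open>0\<close> the principal power is the analytic branch \<open>exp (\<gamma> L)\<close>, so \<open>F = q exp (\<gamma> L)\<close>
  everywhere; this leaves only the isolated zeros of \<open>q\<close>. At such a zero with \<open>exp (L z)\<close> on the
  branch cut, approach from the side where the principal logarithm is continuous.\<close>
lemma principal_powr_eq_branch:
  assumes L: "L holomorphic_on unit_disc" "L 0 = 0"
    and q: "q holomorphic_on unit_disc" "q 0 = 1"
    and F: "F holomorphic_on unit_disc"
    and Fq: "\<And>z. z \<in> unit_disc \<Longrightarrow> F z = q z * exp (L z) powr \<gamma>"
    and z0: "z0 \<in> unit_disc"
  shows "exp (L z0) powr \<gamma> = exp (\<gamma> * L z0)"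
proof -
  have contL: "isCont L z" if "z \<in> unit_disc" for z
    using holomorphic_on_imp_continuous_on[OF L(1)] that
    by (simp add: continuous_on_eq_continuous_at)
  have near: "exp (L z) powr \<gamma> = exp (\<gamma> * L z)" if "\<bar>Im (L z)\<bar> < pi" for z
    using exp_powr_complex[of "L z" \<gamma>] that by (simp add: mult.commute)
  have "((\<lambda>z. \<bar>Im (L z)\<bar>) \<longlongrightarrow> 0) (nhds 0)"
    using contL[of 0] L(2) by (auto simp: isCont_def tendsto_nhds_iff intro!: tendsto_eq_intros)
  then have "\<forall>\<^sub>F z in nhds 0. \<bar>Im (L z)\<bar> < pi"
    by (rule order_tendstoD(2)) simp
  then obtain S where S: "open S" "0 \<in> S" "\<And>z. z \<in> S \<Longrightarrow> \<bar>Im (L z)\<bar> < pi"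
    by (auto simp: eventually_nhds)
  have Fexp: "F z = q z * exp (\<gamma> * L z)" if z: "z \<in> unit_disc" for z
  proof (rule analytic_continuation_open[of "S \<inter> unit_disc" unit_disc F])
    show "(\<lambda>z. q z * exp (\<gamma> * L z)) holomorphic_on unit_disc"
      by (intro holomorphic_intros q L)
    show "F z = q z * exp (\<gamma> * L z)" if "z \<in> S \<inter> unit_disc" for z
      using Fq[of z] near[OF S(3)] that by simp
    have "0 \<in> S \<inter> unit_disc" using S by simp
    then show "S \<inter> unit_disc \<noteq> {}" by blast
  qed (use S F z in auto)
  have eq_q: "exp (L z) powr \<gamma> = exp (\<gamma> * L z)" if "z \<in> unit_disc" "q z \<noteq> 0" for z
    using Fq[OF that(1)] Fexp[OF that(1)] that(2) by simp
  show ?thesis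
  proof (cases "q z0 = 0 \<and> exp (L z0) \<in> \<real>\<^sub>\<le>\<^sub>0")
    case False
    show ?thesis
    proof (cases "q z0 = 0")
      case True
      obtain r where r: "r > 0" "ball z0 r \<subseteq> unit_disc" "\<And>z. z \<in> ball z0 r - {z0} \<Longrightarrow> q z \<noteq> 0"
        by (rule isolated_zeros[OF q(1) open_ball connected_ball z0 True, of 0])
          (use q(2) that in auto)
      have "\<forall>\<^sub>F z in at z0. exp (L z) powr \<gamma> = exp (\<gamma> * L z)"
        unfolding eventually_at_topological
        by (rule exI[of _ "ball z0 r"]) (use r eq_q in auto)
      moreover have "((\<lambda>z. exp (L z) powr \<gamma>) \<longlongrightarrow> exp (L z0) powr \<gamma>) (at z0)"
        using True False contL[OF z0] by (intro tendsto_powr_complex tendsto_intros)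
          (auto simp: isCont_def)
      ultimately have "((\<lambda>z. exp (\<gamma> * L z)) \<longlongrightarrow> exp (L z0) powr \<gamma>) (at z0)"
        by (rule Lim_transform_eventually[rotated])
      moreover have "((\<lambda>z. exp (\<gamma> * L z)) \<longlongrightarrow> exp (\<gamma> * L z0)) (at z0)"
        using contL[OF z0] by (intro tendsto_intros) (auto simp: isCont_def)
      ultimately show ?thesis using tendsto_unique[OF trivial_limit_at] by blast
    qed (use eq_q z0 in auto)
  next
    case True
    define h where "h z = exp (L z)" for z
    have h: "h holomorphic_on unit_disc" unfolding h_def by (intro holomorphic_intros L)
    have h0: "h 0 = 1" by (simp add: h_def L)
    have hz0: "Im (h z0) = 0" "h z0 \<noteq> h 0"
      using True unfolding h0 by (auto simp: h_def complex_nonpos_Reals_iff)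
    then have nonconst: "\<not> h constant_on unit_disc"
      using z0 by (metis constant_on_def centre_in_ball zero_less_one)
    obtain r where r: "r > 0" "ball z0 r \<subseteq> unit_disc" "\<And>z. z \<in> ball z0 r - {z0} \<Longrightarrow> q z \<noteq> 0"
      by (rule isolated_zeros[OF q(1) open_ball connected_ball z0 conjunct1[OF True], of 0])
        (use q(2) that in auto)
    define T where "T = {z. Im (h z) \<ge> 0}"
    \<comment> \<open>\<open>h\<close> is nonconstant, since \<open>h z0\<close> lies on the branch
      cut while \<open>h 0 = 1\<close>. It is therefore open, so points arbitrarily near
      \<open>z0\<close> have the nonreal value \<open>h z0 + \<i> d / 2\<close>; they lie in
      \<open>T\<close> and differ from \<open>z0\<close>.\<close>
    have "z0 islimpt T"
      unfolding islimpt_approachable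
    proof (intro allI impI)
      fix e :: real assume e: "e > 0"
      define U where "U = ball z0 (min e r)"
      have "U \<subseteq> unit_disc" using r(2) by (auto simp: U_def)
      then have "open (h ` U)"
        using h nonconst by (intro open_mapping_thm[of h unit_disc]) (auto simp: U_def)
      moreover have "h z0 \<in> h ` U" using e r(1) by (auto simp: U_def)
      ultimately obtain d where d: "d > 0" "ball (h z0) d \<subseteq> h ` U"
        by (meson open_contains_ball)
      have "h z0 + \<i> * of_real (d / 2) \<in> ball (h z0) d"
        using d(1) by (simp add: dist_norm norm_mult)
      then obtain z where z: "z \<in> U" "h z = h z0 + \<i> * of_real (d / 2)"
        using d(2) by (metis imageE subsetD)
      then have "z \<in> T" "z \<noteq> z0" "dist z z0 < e"
        using hz0(1) d(1) by (auto simp: T_def U_def dist_commute)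
      then show "\<exists>z\<in>T. z \<noteq> z0 \<and> dist z z0 < e" by blast
    qed
    then have nontriv: "at z0 within T \<noteq> bot" by (simp add: trivial_limit_within)
    have "\<forall>\<^sub>F z in at z0 within T. z \<in> ball z0 r - {z0}"
      using r(1) eventually_at_ball'[of r z0 T] by (auto elim: eventually_mono)
    then have ev: "\<forall>\<^sub>F z in at z0 within T. h z powr \<gamma> = exp (\<gamma> * L z)"
      by eventually_elim (use r eq_q h_def in auto)
    have hlim: "(h \<longlongrightarrow> h z0) (at z0 within T)"
      unfolding h_def using tendsto_within_subset[OF contL[OF z0, unfolded isCont_def]]
      by (intro tendsto_intros) auto
    have "((\<lambda>z. Ln (h z)) \<longlongrightarrow> Ln (h z0)) (at z0 within T)"
      using hz0(1) by (intro tendsto_Ln_upper_halfplane hlim)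
        (auto simp: h_def T_def eventually_at_topological)
    then have "((\<lambda>z. exp (\<gamma> * Ln (h z))) \<longlongrightarrow> exp (\<gamma> * Ln (h z0))) (at z0 within T)"
      by (intro tendsto_exp tendsto_mult tendsto_const)
    then have "((\<lambda>z. h z powr \<gamma>) \<longlongrightarrow> h z0 powr \<gamma>) (at z0 within T)"
      by (simp add: powr_def h_def)
    from Lim_transform_eventually[OF this ev]
    have "((\<lambda>z. exp (\<gamma> * L z)) \<longlongrightarrow> h z0 powr \<gamma>) (at z0 within T)" .
    moreover have "((\<lambda>z. exp (\<gamma> * L z)) \<longlongrightarrow> exp (\<gamma> * L z0)) (at z0 within T)"
      using tendsto_within_subset[OF contL[OF z0, unfolded isCont_def]]
      by (intro tendsto_intros) auto
    ultimately show ?thesis using tendsto_unique[OF nontriv] unfolding h_def by blast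
  qed
qed

lemma class_A_branch:
  assumes n: "n \<ge> 1" and p: "p \<ge> 1" and f: "f \<in> class_A p n"
  obtains L k where "L holomorphic_on unit_disc" "L 0 = 0" "k holomorphic_on unit_disc"
    and "\<And>z. z \<in> unit_disc \<Longrightarrow> deriv L z = z ^ (n - 1) * k z"
    and "\<And>z. z \<in> unit_disc \<Longrightarrow> power_quot p f z = exp (L z)"
    and "\<And>z. z \<in> unit_disc \<Longrightarrow> log_deriv_quot p f z = 1 - z * deriv L z / of_nat p"
proof -
  obtain \<phi> where \<phi>: "\<phi> holomorphic_on unit_disc"
    and eq: "\<And>z. z \<in> unit_disc \<Longrightarrow> f z = z ^ p * (1 + z ^ n * \<phi> z)"
    and nz: "\<And>z. z \<in> unit_disc \<Longrightarrow> 1 + z ^ n * \<phi> z \<noteq> 0"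
    using class_A_factor[OF n p f] by blast
  define \<kappa> where "\<kappa> z = 1 + z ^ n * \<phi> z" for z
  have \<kappa>: "\<kappa> holomorphic_on unit_disc" unfolding \<kappa>_def by (intro holomorphic_intros \<phi>)
  have \<kappa>0: "\<kappa> z \<noteq> 0" if "z \<in> unit_disc" for z using nz[OF that] by (simp add: \<kappa>_def)
  obtain l where l: "l holomorphic_on unit_disc" "\<And>z. z \<in> unit_disc \<Longrightarrow> \<kappa> z = exp (l z)"
    using contractible_imp_holomorphic_log[OF \<kappa> convex_imp_contractible[OF convex_ball] \<kappa>0]
    by blast
  \<comment> \<open>\<open>\<kappa> 0 = 1\<close> fixes \<open>l 0\<close> only up to a multiple of
    \<open>2 pi \<i>\<close>; subtracting it gives \<open>L 0 = 0\<close>, which is what ties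
    \<open>L\<close> to the principal branch near 0. The sign is that of \<open>z^p/f\<close>, the
    reciprocal of \<open>\<kappa>\<close>.\<close>
  define L where "L z = l 0 - l z" for z
  \<comment> \<open>The derivative of \<open>\<kappa>\<close> is \<open>z^(n-1) Y\<close>, and
    \<open>L' = - \<kappa>'/\<kappa>\<close>.\<close>
  define Y where "Y z = of_nat n * \<phi> z + z * deriv \<phi> z" for z
  define k where "k z = - Y z / \<kappa> z" for z
  have L: "L holomorphic_on unit_disc" unfolding L_def by (intro holomorphic_intros l)
  have exp_l0: "exp (l 0) = 1" using l(2)[of 0] n by (simp add: \<kappa>_def power_0_left)
  have \<kappa>L: "\<kappa> z = exp (- L z)" if "z \<in> unit_disc" for z
    using l(2)[OF that] exp_l0 by (simp add: L_def exp_diff)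
  have d\<kappa>: "(\<kappa> has_field_derivative - deriv L z * \<kappa> z) (at z)" if z: "z \<in> unit_disc" for z
  proof -
    have "((\<lambda>z. exp (- L z)) has_field_derivative - deriv L z * exp (- L z)) (at z)"
      using holomorphic_derivI[OF L open_ball z] by (auto intro!: derivative_eq_intros)
    then show ?thesis unfolding \<kappa>L[OF z]
      by (rule has_field_derivative_transform_within_open[OF _ open_ball z]) (simp add: \<kappa>L)
  qed
  have "deriv L z = z ^ (n - 1) * k z" if z: "z \<in> unit_disc" for z
  proof -
    have "(\<kappa> has_field_derivative of_nat n * z ^ (n - 1) * \<phi> z + z ^ n * deriv \<phi> z) (at z)"
      unfolding \<kappa>_def using holomorphic_derivI[OF \<phi> open_ball z]
      by (auto intro!: derivative_eq_intros)
    then have "- deriv L z * \<kappa> z = of_nat n * z ^ (n - 1) * \<phi> z + z ^ n * deriv \<phi> z"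
      using d\<kappa>[OF z] by (rule DERIV_unique[rotated])
    also have "z ^ n = z ^ (n - 1) * z" using n by (simp flip: power_Suc2)
    finally have "- deriv L z * \<kappa> z = z ^ (n - 1) * Y z"
      by (simp add: Y_def algebra_simps)
    then have "deriv L z * \<kappa> z = - (z ^ (n - 1) * Y z)"
      by (metis minus_minus minus_mult_left)
    then have "deriv L z = - (z ^ (n - 1) * Y z) / \<kappa> z"
      by (simp only: nonzero_eq_divide_eq[OF \<kappa>0[OF z]])
    then show ?thesis by (simp add: k_def)
  qed
  moreover have "k holomorphic_on unit_disc"
    unfolding k_def Y_def by (intro holomorphic_intros \<kappa> \<kappa>0 \<phi> holomorphic_deriv open_ball) auto
  moreover have "power_quot p f z = exp (L z)" if z: "z \<in> unit_disc" for z
  proof (cases "z = 0")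
    case True
    then show ?thesis by (simp add: power_quot_def L_def)
  next
    case False
    have fz: "f z = z ^ p * exp (- L z)" using eq[OF z] \<kappa>L[OF z] by (simp add: \<kappa>_def)
    show ?thesis using False by (simp add: power_quot_def fz exp_minus inverse_eq_divide)
  qed
  moreover have "log_deriv_quot p f z = 1 - z * deriv L z / of_nat p" if z: "z \<in> unit_disc" for z
  proof (cases "z = 0")
    case True
    then show ?thesis by (simp add: log_deriv_quot_def)
  next
    case False
    have "((\<lambda>z. z ^ p * \<kappa> z) has_field_derivative
        of_nat p * z ^ (p - 1) * \<kappa> z + z ^ p * (- deriv L z * \<kappa> z)) (at z)"
      using d\<kappa>[OF z] by (auto intro!: derivative_eq_intros)
    then have "(f has_field_derivative
        of_nat p * z ^ (p - 1) * \<kappa> z + z ^ p * (- deriv L z * \<kappa> z)) (at z)"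
      by (rule has_field_derivative_transform_within_open[OF _ open_ball z])
        (simp add: eq \<kappa>_def)
    then have "z * deriv f z = of_nat p * (z * z ^ (p - 1)) * \<kappa> z - z * deriv L z * (z ^ p * \<kappa> z)"
      by (simp add: DERIV_imp_deriv algebra_simps)
    also have "z * z ^ (p - 1) = z ^ p" using p by (simp flip: power_Suc)
    also have "of_nat p * z ^ p * \<kappa> z - z * deriv L z * (z ^ p * \<kappa> z)
        = (of_nat p - z * deriv L z) * f z"
      unfolding eq[OF z] \<kappa>_def by (simp add: algebra_simps)
    finally have zd: "z * deriv f z = (of_nat p - z * deriv L z) * f z" .
    have "f z \<noteq> 0" using eq[OF z] nz[OF z] False by simp
    then show ?thesis using False p unfolding log_deriv_quot_def zd
      by (simp add: field_simps)
  qed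
  ultimately show ?thesis using that[of L k] L by (simp add: L_def del: mem_ball)
qed

subsection \<open>Bounds for the real part\<close>

theorem theorem2p6:
  fixes n p :: nat and \<mu> :: complex and \<alpha> \<beta> A B :: real and f :: "complex \<Rightarrow> complex"
  assumes "n \<ge> 1" and "p \<ge> 1"
    and "\<mu> \<noteq> 0"
    and "\<alpha> \<ge> 0" and "complex_of_real \<alpha> + \<i> * complex_of_real \<beta> \<noteq> 0"
    and "-1 \<le> B" and "B \<le> 1" and "A \<noteq> B"
    and integrals_exist: "\<forall>\<zeta>\<in>unit_disc.
          bound_integrand (bound_exponent p n \<mu> \<alpha> \<beta>) A B \<zeta> integrable_on {0..1}"
    and "f \<in> class_N p n \<mu> \<alpha> \<beta> A B"
  shows "\<forall>z\<in>unit_disc.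
    (INF \<zeta>\<in>unit_disc. ereal (Re (bound_fun (bound_exponent p n \<mu> \<alpha> \<beta>) A B \<zeta>)))
      < ereal (Re (power_quot p f z powr (of_real \<alpha> + \<i> * of_real \<beta>))) \<and>
    ereal (Re (power_quot p f z powr (of_real \<alpha> + \<i> * of_real \<beta>)))
      < (SUP \<zeta>\<in>unit_disc. ereal (Re (bound_fun (bound_exponent p n \<mu> \<alpha> \<beta>) A B \<zeta>)))"
proof -
  define \<gamma> where "\<gamma> = complex_of_real \<alpha> + \<i> * complex_of_real \<beta>"
  define c where "c = bound_exponent p n \<mu> \<alpha> \<beta>"
  note n = assms(1) and p = assms(2)
  have \<gamma>: "\<gamma> \<noteq> 0" using assms by (simp add: \<gamma>_def)
  have B: "\<bar>B\<bar> \<le> 1" "A \<noteq> B" using assms by auto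
  have c_def': "c = of_nat p * \<gamma> / (\<mu> * of_nat n)" by (simp add: c_def bound_exponent_def \<gamma>_def)
  have c0: "c \<noteq> 0" using n p \<gamma> \<open>\<mu> \<noteq> 0\<close> by (simp add: c_def')
  have cn: "c * of_nat n = of_nat p * \<gamma> / \<mu>" using n \<open>\<mu> \<noteq> 0\<close> by (simp add: c_def' field_simps)
  have "bound_integrand c A B 0 integrable_on {0..1}"
    using integrals_exist by (simp add: c_def)
  moreover have "bound_integrand c A B 0 = (\<lambda>u. of_real u powr (c - 1))"
    by (auto simp: bound_integrand_def moebius_AB_def)
  ultimately have Re_c: "Re c > 0" using Re_pos_if_powr_integrable[OF c0] by simp
  obtain Q N where Q: "Q holomorphic_on unit_disc"
    and ode: "\<And>z. z \<in> unit_disc \<Longrightarrow> Q z + z * deriv Q z / c = moebius_AB A B z"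
    and dQ: "\<And>z. z \<in> unit_disc \<Longrightarrow>
      deriv Q z = c * N z * (of_real (A - B) / (1 + of_real B * z)\<^sup>2)"
    and N: "\<And>z. z \<in> unit_disc \<Longrightarrow> Re (N z) > 0"
    using moebius_dominant[OF Re_c B] by blast
  have bound: "bound_fun c A B \<zeta> = Q \<zeta>" if "\<zeta> \<in> unit_disc" for \<zeta>
    by (rule bound_fun_eq[OF Re_c Q ode that])

  have fA: "f \<in> class_A p n" using assms by (simp add: class_N_def)
  obtain L k where L: "L holomorphic_on unit_disc" "L 0 = 0" and k: "k holomorphic_on unit_disc"
    and dL: "\<And>z. z \<in> unit_disc \<Longrightarrow> deriv L z = z ^ (n - 1) * k z"
    and pq: "\<And>z. z \<in> unit_disc \<Longrightarrow> power_quot p f z = exp (L z)"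
    and lq: "\<And>z. z \<in> unit_disc \<Longrightarrow> log_deriv_quot p f z = 1 - z * deriv L z / of_nat p"
    using class_A_branch[OF n p fA] by blast
  define F where "F = (\<lambda>z. (1 + \<mu>) * power_quot p f z powr \<gamma>
    - \<mu> * log_deriv_quot p f z * power_quot p f z powr \<gamma>)"
  have "subordinate F (moebius_AB A B)"
    using assms(10) by (simp add: class_N_def F_def \<gamma>_def)
  then obtain w where F: "F holomorphic_on unit_disc" and w: "w holomorphic_on unit_disc"
    "\<And>z. z \<in> unit_disc \<Longrightarrow> norm (w z) < 1"
    and Fw: "\<And>z. z \<in> unit_disc \<Longrightarrow> F z = moebius_AB A B (w z)"
    unfolding subordinate_def by blast
  \<comment> \<open>Inserting \<open>1 - z L'/p\<close> for the logarithmic quotient collects both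
    summands of \<open>F\<close> into one multiple of the principal power. As
    \<open>q 0 = 1\<close>, the factor has only isolated zeros.\<close>
  define q where "q z = 1 + \<mu> * (z * deriv L z / of_nat p)" for z
  have q: "q holomorphic_on unit_disc"
    unfolding q_def using p by (intro holomorphic_intros holomorphic_deriv L) auto
  have Fq: "F z = q z * exp (L z) powr \<gamma>" if "z \<in> unit_disc" for z
    unfolding F_def q_def pq[OF that] lq[OF that] by (simp add: algebra_simps)
  define g where "g z = exp (\<gamma> * L z)" for z
  have g_eq: "power_quot p f z powr \<gamma> = g z" if "z \<in> unit_disc" for z
    unfolding pq[OF that] g_def
    by (rule principal_powr_eq_branch[OF L q _ F Fq that]) (simp add: q_def)
  have g: "g holomorphic_on unit_disc" unfolding g_def by (intro holomorphic_intros L)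
  have dg: "deriv g z = \<gamma> * deriv L z * g z" if z: "z \<in> unit_disc" for z
    unfolding g_def using holomorphic_derivI[OF L(1) open_ball z]
    by (intro DERIV_imp_deriv) (auto intro!: derivative_eq_intros)
  have gF: "g z + z * deriv g z / (c * of_nat n) = F z" if z: "z \<in> unit_disc" for z
    unfolding Fq[OF z] pq[OF z, symmetric] g_eq[OF z] dg[OF z] cn q_def
    using \<gamma> p \<open>\<mu> \<noteq> 0\<close> by (simp add: field_simps)
  have dg': "deriv g z = z ^ (n - 1) * (\<gamma> * k z * g z)" if "z \<in> unit_disc" for z
    unfolding dg[OF that] dL[OF that] by simp
  have kg: "(\<lambda>z. \<gamma> * k z * g z) holomorphic_on unit_disc" by (intro holomorphic_intros k g)
  obtain y where y: "y holomorphic_on unit_disc"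
    and gy: "\<And>z. z \<in> unit_disc \<Longrightarrow> g z - g 0 = z ^ n * y z"
    using diff_eq_power_mult[OF n g kg dg'] by blast
  have g0: "g 0 = 1" by (simp add: g_def L)
  \<comment> \<open>Solving \<open>w (A - B F) = F - 1\<close> for \<open>w\<close>: both terms of
    \<open>F - 1 = (g - 1) + z g'/(c n)\<close> contain \<open>z^n\<close>, and \<open>K\<close> is
    the remaining cofactor, so \<open>w\<close> inherits the zero of order \<open>n\<close>.\<close>
  define K where "K z = (y z + \<gamma> * k z * g z / (c * of_nat n)) / (of_real A - of_real B * F z)" for z
  have AF: "of_real A - of_real B * F z \<noteq> 0" if z: "z \<in> unit_disc" for z
    using moebius_AB_solve(1)[OF B w(2)[OF z]] one_plus_mult_nonzero[OF B(1) w(2)[OF z]] B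
    by (simp add: Fw[OF z])
  have K: "K holomorphic_on unit_disc"
    unfolding K_def using c0 n by (intro holomorphic_intros y k g F AF) auto
  have wK: "w z = z ^ n * K z" if z: "z \<in> unit_disc" for z
  proof -
    have "w z * (of_real A - of_real B * F z) = F z - 1"
      using moebius_AB_solve(2)[OF B w(2)[OF z]] by (simp add: Fw[OF z])
    also have "\<dots> = (g z - g 0) + (z * z ^ (n - 1)) * (\<gamma> * k z * g z) / (c * of_nat n)"
      unfolding gF[OF z, symmetric] dg'[OF z] g0 by simp
    also have "z * z ^ (n - 1) = z ^ n" using n by (simp flip: power_Suc)
    also have "(g z - g 0) + z ^ n * (\<gamma> * k z * g z) / (c * of_nat n)
        = z ^ n * K z * (of_real A - of_real B * F z)"
    proof -
      have "K z * (of_real A - of_real B * F z) = y z + \<gamma> * k z * g z / (c * of_nat n)"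
        using AF[OF z] by (simp add: K_def)
      then show ?thesis unfolding gy[OF z] mult.assoc by (simp add: algebra_simps)
    qed
    finally show ?thesis using AF[OF z] by simp
  qed
  have sub: "g ` unit_disc \<subseteq> Q ` unit_disc"
  proof (rule image_subset_dominant[OF B c0 n Q ode dQ N g y])
    show "g z - 1 = z ^ n * y z" if "z \<in> unit_disc" for z using gy[OF that] g0 by simp
    show "g z + z * deriv g z / (c * of_nat n) = moebius_AB A B (w z)" if "z \<in> unit_disc" for z
      using gF[OF that] Fw[OF that] by simp
    show "norm (w z) \<le> norm z ^ n" if "z \<in> unit_disc" for z
      by (rule higher_order_Schwarz[OF w(1) K w(2) wK that])
  qed
  have openQ: "open (Q ` unit_disc)"
    using Q inj_on_moebius_dominant[OF B c0 Q dQ N] by (intro open_mapping_thm3) auto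
  \<comment> \<open>\<open>g z\<close> is an interior point of the image of \<open>Q\<close>, so
    horizontal shifts by \<open>d / 2\<close> either way are still values of \<open>Q\<close>. This
    gives strictness even where an extremum over the disc is infinite.\<close>
  have shift: "\<exists>\<zeta>\<in>unit_disc. Re (Q \<zeta>) < Re (g z)" "\<exists>\<zeta>\<in>unit_disc. Re (g z) < Re (Q \<zeta>)"
    if z: "z \<in> unit_disc" for z
  proof -
    obtain d where d: "d > 0" "ball (g z) d \<subseteq> Q ` unit_disc"
      using openQ subsetD[OF sub imageI[OF z]] by (auto simp: open_contains_ball)
    have "g z - of_real (d / 2) \<in> ball (g z) d" "g z + of_real (d / 2) \<in> ball (g z) d"
      using d(1) by (simp_all add: dist_norm)
    from this[THEN subsetD[OF d(2)]]
    obtain x x' where "g z - of_real (d / 2) = Q x" "x \<in> unit_disc"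
      "g z + of_real (d / 2) = Q x'" "x' \<in> unit_disc"
      by (elim imageE)
    moreover have "Re (g z - of_real (d / 2)) < Re (g z)" "Re (g z) < Re (g z + of_real (d / 2))"
      using d(1) by simp_all
    ultimately show "\<exists>\<zeta>\<in>unit_disc. Re (Q \<zeta>) < Re (g z)" "\<exists>\<zeta>\<in>unit_disc. Re (g z) < Re (Q \<zeta>)"
      by metis+
  qed
  show ?thesis
    unfolding c_def[symmetric] \<gamma>_def[symmetric] INF_less_iff less_SUP_iff
    using shift by (simp add: g_eq bound del: mem_ball)
qed

end
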